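(* There is $\kappa>0$ such that for every (small) angular frequency $\omega_0\in(0,\kappa)$ and every unit vector $\boldsymbol a\in\mathbb S$ the following holds. For $\boldsymbol l\in\mathbb Z^2$ define $$\tau_{\boldsymbol l}=\frac{2\pi}{a}|\boldsymbol l|,\qquad \widehat x_{\boldsymbol l}=\begin{cases}\dfrac{\boldsymbol l}{|\boldsymbol l|},&\boldsymbol l\neq\boldsymbol 0,\\[2mm] \boldsymbol a,&\boldsymbol l=\boldsymbol 0.\end{cases}$$ Then for each $\boldsymbol l\in\mathbb Z^2$ the Fourier coefficient $\widehat{\boldsymbol\sigma}_{\boldsymbol l}$ of the variance $\boldsymbol\sigma^2$ of the random elastic source $\boldsymbol F=\boldsymbol g+\boldsymbol\sigma\dot W_x$ is determined by the covariance data $$\mathbf C\big[\boldsymbol u_\alpha^\infty(\widehat x_{\boldsymbol l};c_\alpha(\omega_0+\tau_{\boldsymbol l})),\,\boldsymbol u_\beta^\infty(\widehat x_{\boldsymbol l};c_\beta\omega_0)\big],\qquad(\alpha,\beta)\in\{(p,p),(p,s),(s,p),(s,s)\};$$ that is, if two admissible sources, given by $(\boldsymbol g,\boldsymbol\sigma)$ and $(\boldsymbol g',\boldsymbol\sigma')$, have the same such covariance data for this $\boldsymbol l$ and all four pairs $(\alpha,\beta)$, then $\widehat{\boldsymbol\sigma}_{\boldsymbol l}=\widehat{\boldsymbol\sigma'}_{\boldsymbol l}$.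
   Context: Let $a>0$, $\Omega=(-a/2,a/2)\times(-a/2,a/2)\subset\mathbb R^2$ and $\mathbb S=\{x\in\mathbb R^2:|x|=1\}$ (directions are column vectors). Let $\lambda,\mu$ be fixed Lamé constants with $\mu>0$, $\lambda+\mu>0$, and $c_p=\sqrt{\lambda+2\mu}$, $c_s=\sqrt\mu$. For angular frequency $\omega>0$ put $k_p=\omega/c_p$, $k_s=\omega/c_s$, and $\gamma_\xi=\frac{\mathrm e^{\mathrm i\pi/4}}{\sqrt{8\pi k_\xi}}$ for $\xi\in\{p,s\}$. An admissible source is $\boldsymbol F=\boldsymbol g+\boldsymbol\sigma\dot W_x$, where $\boldsymbol g=(g_1,g_2)^\top$ is a deterministic real vector function, $\boldsymbol\sigma=\mathrm{diag}(\sigma_1,\sigma_2)$ is deterministic with $\sigma_1,\sigma_2\ge0$, all $g_j,\sigma_j$ are independent of $\omega$ and compactly supported in $\Omega$, with $g_j,\sigma_j^2\in L^2(\Omega)$, and $\dot W_x$ is white noise, the derivative of $W(x)=(W_1(x),W_2(x))^\top$ with $W_1,W_2$ independent one-dimensional two-parameter Brownian sheets. Integrals against $\mathrm dW_y$ are Wiener integrals (the white noise has delta correlation). $\mathbf E$ denotes expectation, and for $\mathbb C^2$-valued random vectors $\mathbf C[\boldsymbol u,\boldsymbol v]=\mathbf E\big[(\boldsymbol u-\mathbf E[\boldsymbol u])\,\overline{(\boldsymbol v-\mathbf E[\boldsymbol v])}^{\top}\big]\in\mathbb C^{2\times2}$. The displacement $\boldsymbol u$ solves $\mu\Delta\boldsymbol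 u+(\lambda+\mu)\nabla\nabla\cdot\boldsymbol u+\omega^2\boldsymbol u=-\boldsymbol F$ in $\mathbb R^2$, with its compressional and shear parts $\boldsymbol u_p,\boldsymbol u_s$ satisfying the Sommerfeld radiation condition $\lim_{r=|x|\to\infty}\sqrt r(\partial_r\boldsymbol u_\xi-\mathrm ik_\xi\boldsymbol u_\xi)=0$. Its compressional and shear far-field patterns at angular frequency $\omega$ in direction $\widehat x\in\mathbb S$ are $$\boldsymbol u_p^\infty(\widehat x;\omega)=\gamma_p\frac{k_p^2}{\omega^2}\int_\Omega\widehat x\widehat x^\top\mathrm e^{-\mathrm ik_p\widehat x\cdot y}\boldsymbol F(y)\,\mathrm dy,\qquad \boldsymbol u_s^\infty(\widehat x;\omega)=\gamma_s\frac{k_s^2}{\omega^2}\int_\Omega(\mathbb I-\widehat x\widehat x^\top)\mathrm e^{-\mathrm ik_s\widehat x\cdot y}\boldsymbol F(y)\,\mathrm dy,$$ where $\mathbb I$ is the $2\times2$ identity and $\boldsymbol F(y)\,\mathrm dy$ means $\boldsymbol g(y)\,\mathrm dy+\boldsymbol\sigma(y)\,\mathrm dW_y$. In the notation $\boldsymbol u_\xi^\infty(\widehat x;c_\xi\omega')$ the angular frequency is $c_\xi\omega'$, and $k_\xi,\gamma_\xi$ are taken at that frequency (so $k_\xi=\omega'$). The Fourier basis is $\phi_{\boldsymbol l}(x)=\mathrm e^{\mathrm i\frac{2\pi}{a}\boldsymbol l\cdot x}$, $\boldsymbol l\in\mathbb Z^2$. The symbol $\widehat{\boldsymbol\sigma}_{\boldsymbol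 l}$ denotes the (diagonal-matrix-valued) Fourier coefficient of $\boldsymbol\sigma^2=\mathrm{diag}(\sigma_1^2,\sigma_2^2)$: $\widehat{\boldsymbol\sigma}_{\boldsymbol l}=\frac1{a^2}\int_\Omega\boldsymbol\sigma^2(x)\overline{\phi_{\boldsymbol l}(x)}\,\mathrm dx$; similarly $\widehat{\boldsymbol\sigma'}_{\boldsymbol l}$ is that of $(\boldsymbol\sigma')^2$. $|\boldsymbol l|$ is the Euclidean norm. *)

theory Defs
  imports "HOL-Probability.Probability"
begin

section \<open>White noise and Wiener integrals\<close>

definition centered_gaussian :: "'w measure \<Rightarrow> ('w \<Rightarrow> real) \<Rightarrow> bool" where
  "centered_gaussian M X \<longleftrightarrow> X \<in> borel_measurable M \<and>
     ((AE w in M. X w = 0) \<or> (\<exists>s>0. distributed M lborel X (normal_density 0 s)))"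

text \<open>
  The domain of interest straddles both coordinate axes, so the sheet is two-sided: its
  covariance is the product of the covariances of two-sided Brownian motions, which on
  the positive quadrant is the familiar \<open>min x\<^sub>1 y\<^sub>1 * min x\<^sub>2 y\<^sub>2\<close>.
\<close>

definition sheet_covariance :: "real^2 \<Rightarrow> real^2 \<Rightarrow> real" where
  "sheet_covariance x y = (\<Prod>i\<in>UNIV. (\<bar>x$i\<bar> + \<bar>y$i\<bar> - \<bar>x$i - y$i\<bar>) / 2)"

text \<open>Continuity of sample paths is not needed for Wiener integrals and is not required.\<close>

definition brownian_sheet :: "'w measure \<Rightarrow> (real^2 \<Rightarrow> 'w \<Rightarrow> real) \<Rightarrow> bool" where
  "brownian_sheet M B \<longleftrightarrow>
     (\<forall>A c. finite A \<longrightarrow> centered_gaussian M (\<lambda>w. \<Sum>x\<in>A. c x * B x w)) \<and>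
     (\<forall>x y. (LINT w|M. B x w * B y w) = sheet_covariance x y)"

definition brownian_sheet_pair :: "'w measure \<Rightarrow> (2 \<Rightarrow> real^2 \<Rightarrow> 'w \<Rightarrow> real) \<Rightarrow> bool" where
  "brownian_sheet_pair M W \<longleftrightarrow> prob_space M \<and>
     (\<forall>j. brownian_sheet M (W j)) \<and>
     prob_space.indep_vars M (\<lambda>j. PiM UNIV (\<lambda>x. borel)) (\<lambda>j w x. W j x w) UNIV"

text \<open>
  A triple \<open>(c, s, t)\<close> in a step list contributes the value \<open>c\<close> on the rectangle with
  corners \<open>s \<le> t\<close>; whether the rectangle is closed or half-open is immaterial, because its
  boundary is a null set.
\<close>

type_synonym step_list = "(complex \<times> (real^2) \<times> (real^2)) list"

definition proper_steps :: "step_list \<Rightarrow> bool" where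
  "proper_steps S \<longleftrightarrow> (\<forall>(c, s, t) \<in> set S. s \<le> t)"

definition step_fun :: "step_list \<Rightarrow> real^2 \<Rightarrow> complex" where
  "step_fun S y = (\<Sum>(c, s, t) \<leftarrow> S. indicator (cbox s t) y * c)"

definition rect_increment :: "(real^2 \<Rightarrow> 'w \<Rightarrow> real) \<Rightarrow> real^2 \<Rightarrow> real^2 \<Rightarrow> 'w \<Rightarrow> real" where
  "rect_increment B s t w =
     B t w - B (vector [s$1, t$2]) w - B (vector [t$1, s$2]) w + B s w"

definition step_integral :: "(real^2 \<Rightarrow> 'w \<Rightarrow> real) \<Rightarrow> step_list \<Rightarrow> 'w \<Rightarrow> complex" where
  "step_integral B S w = (\<Sum>(c, s, t) \<leftarrow> S. c * of_real (rect_increment B s t w))"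

definition is_wiener_integral ::
  "'w measure \<Rightarrow> (real^2 \<Rightarrow> 'w \<Rightarrow> real) \<Rightarrow> (real^2 \<Rightarrow> complex) \<Rightarrow> ('w \<Rightarrow> complex) \<Rightarrow> bool" where
  "is_wiener_integral M B f X \<longleftrightarrow>
     f \<in> borel_measurable lebesgue \<and> X \<in> borel_measurable M \<and>
     (\<exists>S. (\<forall>n. proper_steps (S n)) \<and>
        (\<lambda>n. \<integral>\<^sup>+ y. ennreal ((cmod (f y - step_fun (S n) y))\<^sup>2) \<partial>lebesgue) \<longlonglongrightarrow> 0 \<and>
        (\<lambda>n. \<integral>\<^sup>+ w. ennreal ((cmod (X w - step_integral B (S n) w))\<^sup>2) \<partial>M) \<longlonglongrightarrow> 0)"

text \<open>For square-integrable integrands the choice is unique up to almost sure equality.\<close>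

definition wiener_integral ::
  "'w measure \<Rightarrow> (real^2 \<Rightarrow> 'w \<Rightarrow> real) \<Rightarrow> (real^2) set \<Rightarrow> (real^2 \<Rightarrow> complex) \<Rightarrow> 'w \<Rightarrow> complex" where
  "wiener_integral M B D f = (SOME X. is_wiener_integral M B (\<lambda>y. indicator D y * f y) X)"

section \<open>Sources\<close>

definition domain_square :: "real \<Rightarrow> (real^2) set" where
  "domain_square a = box (vec (- a / 2)) (vec (a / 2))"

definition square_integrable_on :: "(real^2) set \<Rightarrow> (real^2 \<Rightarrow> real) \<Rightarrow> bool" where
  "square_integrable_on D f \<longleftrightarrow>
     f \<in> borel_measurable (lebesgue_on D) \<and> integrable (lebesgue_on D) (\<lambda>x. (f x)\<^sup>2)"

definition compactly_supported_in :: "(real^2) set \<Rightarrow> (real^2 \<Rightarrow> 'b::zero) \<Rightarrow> bool" where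
  "compactly_supported_in D f \<longleftrightarrow> (\<exists>K. compact K \<and> K \<subseteq> D \<and> (\<forall>x. x \<notin> K \<longrightarrow> f x = 0))"

text \<open>The diagonal matrix-valued strength is represented by the vector of its diagonal entries.\<close>

definition admissible_source :: "real \<Rightarrow> (real^2 \<Rightarrow> real^2) \<Rightarrow> (real^2 \<Rightarrow> real^2) \<Rightarrow> bool" where
  "admissible_source a g \<sigma> \<longleftrightarrow>
     compactly_supported_in (domain_square a) g \<and>
     compactly_supported_in (domain_square a) \<sigma> \<and>
     (\<forall>x j. 0 \<le> \<sigma> x $ j) \<and>
     (\<forall>j. square_integrable_on (domain_square a) (\<lambda>x. g x $ j)) \<and>
     (\<forall>j. square_integrable_on (domain_square a) (\<lambda>x. (\<sigma> x $ j)\<^sup>2))"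

section \<open>Far-field patterns\<close>

definition diag_mat :: "real^2 \<Rightarrow> complex^2^2" where
  "diag_mat v = (\<chi> i j. if i = j then of_real (v $ i) else 0)"

definition scale_mat :: "complex \<Rightarrow> complex^2^2 \<Rightarrow> complex^2^2" where
  "scale_mat c A = (\<chi> i j. c * A $ i $ j)"

definition complex_vec :: "real^2 \<Rightarrow> complex^2" where
  "complex_vec v = (\<chi> i. of_real (v $ i))"

text \<open>\<open>outer_prod u v\<close> is \<open>u\<close> times the conjugate transpose of \<open>v\<close>.\<close>

definition outer_prod :: "complex^2 \<Rightarrow> complex^2 \<Rightarrow> complex^2^2" where
  "outer_prod u v = (\<chi> i j. u $ i * cnj (v $ j))"

datatype wave_mode = Compressional | Shear

fun wave_speed :: "real \<Rightarrow> real \<Rightarrow> wave_mode \<Rightarrow> real" where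
  "wave_speed lam mu Compressional = sqrt (lam + 2 * mu)"
| "wave_speed lam mu Shear = sqrt mu"

fun polarization :: "wave_mode \<Rightarrow> real^2 \<Rightarrow> complex^2^2" where
  "polarization Compressional d = outer_prod (complex_vec d) (complex_vec d)"
| "polarization Shear d = mat 1 - outer_prod (complex_vec d) (complex_vec d)"

definition gamma_coeff :: "real \<Rightarrow> complex" where
  "gamma_coeff k = exp (\<i> * of_real (pi / 4)) / of_real (sqrt (8 * pi * k))"

text \<open>\<open>source_integral\<close> is the integral over \<open>D\<close> of \<open>K(y) F(y) dy\<close>, with
  \<open>F(y) dy = g(y) dy + \<sigma>(y) dW\<^sub>y\<close>.\<close>

definition source_integral ::
  "'w measure \<Rightarrow> (2 \<Rightarrow> real^2 \<Rightarrow> 'w \<Rightarrow> real) \<Rightarrow> (real^2) set \<Rightarrow> (real^2 \<Rightarrow> real^2) \<Rightarrow>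
   (real^2 \<Rightarrow> real^2) \<Rightarrow> (real^2 \<Rightarrow> complex^2^2) \<Rightarrow> 'w \<Rightarrow> complex^2" where
  "source_integral M W D g \<sigma> K w =
     (LINT y:D|lebesgue. K y *v complex_vec (g y)) +
     (\<chi> i. \<Sum>j\<in>UNIV. wiener_integral M (W j) D (\<lambda>y. (K y ** diag_mat (\<sigma> y)) $ i $ j) w)"

definition far_field ::
  "real \<Rightarrow> real \<Rightarrow> real \<Rightarrow> 'w measure \<Rightarrow> (2 \<Rightarrow> real^2 \<Rightarrow> 'w \<Rightarrow> real) \<Rightarrow> (real^2 \<Rightarrow> real^2) \<Rightarrow>
   (real^2 \<Rightarrow> real^2) \<Rightarrow> wave_mode \<Rightarrow> real^2 \<Rightarrow> real \<Rightarrow> 'w \<Rightarrow> complex^2" where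
  "far_field a lam mu M W g \<sigma> m d \<omega> w =
     (let k = \<omega> / wave_speed lam mu m in
      (gamma_coeff k * of_real (k\<^sup>2 / \<omega>\<^sup>2)) *s
      source_integral M W (domain_square a) g \<sigma>
        (\<lambda>y. scale_mat (exp (- \<i> * of_real (k * (d \<bullet> y)))) (polarization m d)) w)"

definition covariance_mat ::
  "'w measure \<Rightarrow> ('w \<Rightarrow> complex^2) \<Rightarrow> ('w \<Rightarrow> complex^2) \<Rightarrow> complex^2^2" where
  "covariance_mat M u v =
     (LINT w|M. outer_prod (u w - (LINT w'|M. u w')) (v w - (LINT w'|M. v w')))"

section \<open>Fourier coefficients and measurement configuration\<close>

definition lattice_vec :: "int^2 \<Rightarrow> real^2" where
  "lattice_vec l = (\<chi> i. of_int (l $ i))"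

definition fourier_basis :: "real \<Rightarrow> int^2 \<Rightarrow> real^2 \<Rightarrow> complex" where
  "fourier_basis a l x = exp (\<i> * of_real (2 * pi / a * (lattice_vec l \<bullet> x)))"

definition variance_coeff :: "real \<Rightarrow> (real^2 \<Rightarrow> real^2) \<Rightarrow> int^2 \<Rightarrow> complex^2^2" where
  "variance_coeff a \<sigma> l = (1 / a\<^sup>2) *\<^sub>R
     (LINT x:domain_square a|lebesgue.
        scale_mat (cnj (fourier_basis a l x)) (diag_mat (\<sigma> x) ** diag_mat (\<sigma> x)))"

definition tau :: "real \<Rightarrow> int^2 \<Rightarrow> real" where
  "tau a l = 2 * pi / a * norm (lattice_vec l)"

definition obs_direction :: "real^2 \<Rightarrow> int^2 \<Rightarrow> real^2" where
  "obs_direction d l =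
     (if l = 0 then d else (1 / norm (lattice_vec l)) *\<^sub>R lattice_vec l)"

definition covariance_data ::
  "real \<Rightarrow> real \<Rightarrow> real \<Rightarrow> 'w measure \<Rightarrow> (2 \<Rightarrow> real^2 \<Rightarrow> 'w \<Rightarrow> real) \<Rightarrow> (real^2 \<Rightarrow> real^2) \<Rightarrow>
   (real^2 \<Rightarrow> real^2) \<Rightarrow> real \<Rightarrow> real^2 \<Rightarrow> int^2 \<Rightarrow> wave_mode \<Rightarrow> wave_mode \<Rightarrow> complex^2^2" where
  "covariance_data a lam mu M W g \<sigma> \<omega>\<^sub>0 d l m n =
     covariance_mat M
       (far_field a lam mu M W g \<sigma> m (obs_direction d l)
          (wave_speed lam mu m * (\<omega>\<^sub>0 + tau a l)))
       (far_field a lam mu M W g \<sigma> n (obs_direction d l)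
          (wave_speed lam mu n * \<omega>\<^sub>0))"

end

theory Submission
  imports Defs
begin

text \<open>
  Write \<open>P\<^sub>p\<close>, \<open>P\<^sub>s\<close> for the two polarization projections in the observation direction.
  The wave numbers of the two measured patterns are \<open>\<omega>\<^sub>0 + \<tau>\<^sub>l\<close> and \<open>\<omega>\<^sub>0\<close> for either mode, so the
  product of the two plane waves is the conjugated Fourier mode of index \<open>l\<close>, and by the Ito
  isometry the covariance for the modes \<open>m\<close>, \<open>n\<close> is a nonzero constant times
  \<open>P\<^sub>m V P\<^sub>n\<^sup>*\<close>, where \<open>V\<close> is \<open>a\<^sup>2\<close> times the Fourier coefficient. Since
  \<open>P\<^sub>p + P\<^sub>s\<close> is the identity, summing over \<open>m\<close> and \<open>n\<close> recovers \<open>V\<close>. The Ito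
  isometry presupposes that Wiener integrals of square-integrable functions exist, which rests on
  the density of step functions and the completeness of \<open>L\<^sup>2\<close>.
\<close>

section \<open>Square-integrable functions\<close>

text \<open>The Wiener integral is picked by \<open>SOME\<close>, so nothing is known about it until
  some integral has been shown to exist; this is why approximation and completeness have to precede
  every covariance. The isometry for step functions is stated for two sheets whose joint covariance
  is \<open>q\<close> times the sheet covariance: \<open>q = 1\<close> gives the norm identity
  behind existence, while \<open>q = of_bool (i = j)\<close> absorbs the independence of the two
  components into the same computation. The two sources may live on different probability spaces, so
  their random patterns cannot be compared directly; each covariance is instead evaluated to an
  explicit deterministic formula. Since the Fourier coefficient is a diagonal matrix, it is enough
  to compare the diagonal entries of these formulas.\<close>

definition square_int :: "'a measure \<Rightarrow> ('a \<Rightarrow> complex) \<Rightarrow> bool" where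
  "square_int M f \<longleftrightarrow> f \<in> borel_measurable M \<and> integrable M (\<lambda>x. (cmod (f x))\<^sup>2)"

lemma borel_measurable_cnj [measurable (raw)]:
  "f \<in> borel_measurable M \<Longrightarrow> (\<lambda>x. cnj (f x)) \<in> borel_measurable M"
  by (rule borel_measurable_continuous_on[of cnj]) (auto intro: continuous_intros)

lemma square_intD:
  assumes "square_int M f"
  shows "f \<in> borel_measurable M" "integrable M (\<lambda>x. (cmod (f x))\<^sup>2)"
  using assms by (auto simp: square_int_def)

text \<open>The nonnegative integral is the form in which \<open>is_wiener_integral\<close> measures
  distances, and estimates in it carry no integrability conditions; the Bochner form serves the
  inner products.\<close>

lemma square_int_iff_nn_integral:
  "square_int M f \<longleftrightarrow>
     f \<in> borel_measurable M \<and> (\<integral>\<^sup>+x. ennreal ((cmod (f x))\<^sup>2) \<partial>M) < \<infinity>"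
  by (auto simp: square_int_def integrable_iff_bounded)

lemma nn_integral_cmod_square:
  "square_int M f \<Longrightarrow>
     (\<integral>\<^sup>+x. ennreal ((cmod (f x))\<^sup>2) \<partial>M) = ennreal (LINT x|M. (cmod (f x))\<^sup>2)"
  by (auto simp: square_int_def nn_integral_eq_integral)

lemma cmod_add_square_le: "(cmod (x + y))\<^sup>2 \<le> 2 * (cmod x)\<^sup>2 + 2 * (cmod y)\<^sup>2"
proof -
  have "(cmod (x + y))\<^sup>2 \<le> (cmod x + cmod y)\<^sup>2"
    by (intro power_mono norm_triangle_ineq) auto
  also have "\<dots> \<le> 2 * (cmod x)\<^sup>2 + 2 * (cmod y)\<^sup>2"
    using sum_squares_bound[of "cmod x" "cmod y"] by (simp add: power2_sum)
  finally show ?thesis .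
qed

text \<open>A triangle inequality for squared norms: the constant 2 is the price for never taking
  roots of extended nonnegative numbers.\<close>

lemma nn_integral_cmod_add_square_le:
  assumes [measurable]: "f \<in> borel_measurable M" "g \<in> borel_measurable M"
  shows "(\<integral>\<^sup>+x. ennreal ((cmod (f x + g x))\<^sup>2) \<partial>M) \<le>
     2 * (\<integral>\<^sup>+x. ennreal ((cmod (f x))\<^sup>2) \<partial>M) + 2 * (\<integral>\<^sup>+x. ennreal ((cmod (g x))\<^sup>2) \<partial>M)"
proof -
  have "(\<integral>\<^sup>+x. ennreal ((cmod (f x + g x))\<^sup>2) \<partial>M) \<le>
     (\<integral>\<^sup>+x. 2 * ennreal ((cmod (f x))\<^sup>2) + 2 * ennreal ((cmod (g x))\<^sup>2) \<partial>M)"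
  proof (rule nn_integral_mono)
    fix x
    have "ennreal ((cmod (f x + g x))\<^sup>2) \<le> ennreal (2 * (cmod (f x))\<^sup>2 + 2 * (cmod (g x))\<^sup>2)"
      by (rule ennreal_leI[OF cmod_add_square_le])
    then show "ennreal ((cmod (f x + g x))\<^sup>2) \<le>
        2 * ennreal ((cmod (f x))\<^sup>2) + 2 * ennreal ((cmod (g x))\<^sup>2)"
      by (simp add: ennreal_plus ennreal_mult')
  qed
  also have "\<dots> = 2 * (\<integral>\<^sup>+x. ennreal ((cmod (f x))\<^sup>2) \<partial>M) +
      2 * (\<integral>\<^sup>+x. ennreal ((cmod (g x))\<^sup>2) \<partial>M)"
    by (subst nn_integral_add) (auto simp: nn_integral_cmult)
  finally show ?thesis .
qed

lemma square_int_add: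
  assumes "square_int M f" "square_int M g"
  shows "square_int M (\<lambda>x. f x + g x)"
  using assms nn_integral_cmod_add_square_le[of f M g]
  by (auto simp: square_int_iff_nn_integral ennreal_mult_less_top elim!: le_less_trans)

lemma square_int_cmult: "square_int M f \<Longrightarrow> square_int M (\<lambda>x. c * f x)"
  by (auto simp: square_int_def norm_mult power_mult_distrib)

lemma square_int_diff:
  assumes "square_int M f" "square_int M g"
  shows "square_int M (\<lambda>x. f x - g x)"
  using square_int_add[OF assms(1) square_int_cmult[OF assms(2), of "-1"]] by simp

lemma square_int_const: "finite_measure M \<Longrightarrow> square_int M (\<lambda>_. c)"
  by (auto simp: square_int_def intro: finite_measure.integrable_const)

lemma square_int_integrable_mult:
  assumes "square_int M f" "square_int M g"
  shows "integrable M (\<lambda>x. f x * cnj (g x))"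
proof (rule Bochner_Integration.integrable_bound)
  show "integrable M (\<lambda>x. (cmod (f x))\<^sup>2 + (cmod (g x))\<^sup>2)"
    using assms by (auto simp: square_int_def)
  show "(\<lambda>x. f x * cnj (g x)) \<in> borel_measurable M"
    using assms by (auto simp: square_int_def)
  show "AE x in M. norm (f x * cnj (g x)) \<le> norm ((cmod (f x))\<^sup>2 + (cmod (g x))\<^sup>2)"
  proof (rule AE_I2)
    fix x
    have "2 * (cmod (f x) * cmod (g x)) \<le> (cmod (f x))\<^sup>2 + (cmod (g x))\<^sup>2"
      using sum_squares_bound[of "cmod (f x)" "cmod (g x)"] by simp
    moreover have "0 \<le> cmod (f x) * cmod (g x)" by simp
    ultimately have "cmod (f x) * cmod (g x) \<le> (cmod (f x))\<^sup>2 + (cmod (g x))\<^sup>2" by linarith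
    then show "norm (f x * cnj (g x)) \<le> norm ((cmod (f x))\<^sup>2 + (cmod (g x))\<^sup>2)"
      by (simp add: norm_mult)
  qed
qed

text \<open>Square integrability makes both sides of the extended-valued inequality finite, so it
  descends to the reals.\<close>

lemma Cauchy_Schwarz_square_int:
  assumes f: "square_int M f" and g: "square_int M g"
  shows "(LINT x|M. cmod (f x) * cmod (g x)) \<le>
    sqrt (LINT x|M. (cmod (f x))\<^sup>2) * sqrt (LINT x|M. (cmod (g x))\<^sup>2)"
proof -
  have [measurable]: "f \<in> borel_measurable M" "g \<in> borel_measurable M"
    using f g by (auto simp: square_int_def)
  have int: "integrable M (\<lambda>x. cmod (f x) * cmod (g x))"
    using integrable_norm[OF square_int_integrable_mult[OF f g]] by (simp add: norm_mult)
  have "(\<integral>\<^sup>+x. ennreal (cmod (f x)) * ennreal (cmod (g x)) \<partial>M)\<^sup>2 \<le>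
      (\<integral>\<^sup>+x. (ennreal (cmod (f x)))\<^sup>2 \<partial>M) * (\<integral>\<^sup>+x. (ennreal (cmod (g x)))\<^sup>2 \<partial>M)"
    by (rule Cauchy_Schwarz_nn_integral) auto
  then have "ennreal ((LINT x|M. cmod (f x) * cmod (g x))\<^sup>2) \<le>
      ennreal ((LINT x|M. (cmod (f x))\<^sup>2) * (LINT x|M. (cmod (g x))\<^sup>2))"
    using nn_integral_eq_integral[OF int]
    by (simp add: ennreal_mult[symmetric] ennreal_power nn_integral_cmod_square f g)
  then have "(LINT x|M. cmod (f x) * cmod (g x))\<^sup>2 \<le>
      (LINT x|M. (cmod (f x))\<^sup>2) * (LINT x|M. (cmod (g x))\<^sup>2)"
    by (subst (asm) ennreal_le_iff) auto
  then show ?thesis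
    by (metis real_le_rsqrt real_sqrt_mult)
qed

section \<open>Limits in L^2: continuity of the inner product and completeness\<close>

text \<open>With the errors \<open>D n = f - F n\<close> and \<open>E n = h - H n\<close>, the
  product of \<open>F n\<close> and the conjugate of \<open>H n\<close> is that of \<open>f\<close>
  and \<open>h\<close> plus three terms, each containing an error. Cauchy-Schwarz bounds these terms
  by norms that tend to 0.\<close>

lemma tendsto_inner_product:
  fixes F H :: "nat \<Rightarrow> 'a \<Rightarrow> complex"
  assumes F: "\<And>n. square_int M (F n)" and H: "\<And>n. square_int M (H n)"
    and f: "square_int M f" and h: "square_int M h"
    and Ff: "(\<lambda>n. \<integral>\<^sup>+x. ennreal ((cmod (f x - F n x))\<^sup>2) \<partial>M) \<longlonglongrightarrow> 0"
    and Hh: "(\<lambda>n. \<integral>\<^sup>+x. ennreal ((cmod (h x - H n x))\<^sup>2) \<partial>M) \<longlonglongrightarrow> 0"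
  shows "(\<lambda>n. LINT x|M. F n x * cnj (H n x)) \<longlonglongrightarrow> (LINT x|M. f x * cnj (h x))"
proof -
  define N where "N u = sqrt (LINT x|M. (cmod (u x))\<^sup>2)" for u :: "'a \<Rightarrow> complex"
  define D where "D n x = f x - F n x" for n x
  define E where "E n x = h x - H n x" for n x
  have D: "square_int M (D n)" and E: "square_int M (E n)" for n
    unfolding D_def E_def by (intro square_int_diff F H f h)+
  have ND: "(\<lambda>n. N (D n)) \<longlonglongrightarrow> 0"
  proof -
    have "(\<lambda>n. ennreal (LINT x|M. (cmod (D n x))\<^sup>2)) \<longlonglongrightarrow> ennreal 0"
      using Ff unfolding nn_integral_cmod_square[OF D, symmetric] by (simp add: D_def)
    then have "(\<lambda>n. LINT x|M. (cmod (D n x))\<^sup>2) \<longlonglongrightarrow> 0"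
      by (subst (asm) tendsto_ennreal_iff) auto
    from tendsto_real_sqrt[OF this] show ?thesis by (simp add: N_def)
  qed
  have NE: "(\<lambda>n. N (E n)) \<longlonglongrightarrow> 0"
  proof -
    have "(\<lambda>n. ennreal (LINT x|M. (cmod (E n x))\<^sup>2)) \<longlonglongrightarrow> ennreal 0"
      using Hh unfolding nn_integral_cmod_square[OF E, symmetric] by (simp add: E_def)
    then have "(\<lambda>n. LINT x|M. (cmod (E n x))\<^sup>2) \<longlonglongrightarrow> 0"
      by (subst (asm) tendsto_ennreal_iff) auto
    from tendsto_real_sqrt[OF this] show ?thesis by (simp add: N_def)
  qed
  have CS: "cmod (LINT x|M. u x * cnj (v x)) \<le> N u * N v"
    if "square_int M u" "square_int M v" for u v
  proof -
    have "cmod (LINT x|M. u x * cnj (v x)) \<le> (LINT x|M. cmod (u x * cnj (v x)))"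
      by (rule integral_norm_bound)
    also have "\<dots> \<le> N u * N v"
      using Cauchy_Schwarz_square_int[OF that] by (simp add: norm_mult N_def)
    finally show ?thesis .
  qed
  have bound: "cmod ((LINT x|M. F n x * cnj (H n x)) - (LINT x|M. f x * cnj (h x)))
      \<le> N (D n) * N (E n) + N f * N (E n) + N (D n) * N h" for n
  proof -
    have "(LINT x|M. F n x * cnj (H n x)) =
      (LINT x|M. f x * cnj (h x) + D n x * cnj (E n x) - f x * cnj (E n x) - D n x * cnj (h x))"
      by (rule Bochner_Integration.integral_cong) (auto simp: D_def E_def algebra_simps)
    also have "\<dots> = (LINT x|M. f x * cnj (h x)) + (LINT x|M. D n x * cnj (E n x))
       - (LINT x|M. f x * cnj (E n x)) - (LINT x|M. D n x * cnj (h x))"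
      using D E f h by (simp add: square_int_integrable_mult)
    finally have "(LINT x|M. F n x * cnj (H n x)) - (LINT x|M. f x * cnj (h x)) =
        (LINT x|M. D n x * cnj (E n x)) - (LINT x|M. f x * cnj (E n x)) - (LINT x|M. D n x * cnj (h x))"
      by simp
    also have "cmod \<dots> \<le> cmod (LINT x|M. D n x * cnj (E n x)) +
        cmod (LINT x|M. f x * cnj (E n x)) + cmod (LINT x|M. D n x * cnj (h x))"
      by (rule order_trans[OF norm_triangle_ineq4 add_right_mono[OF norm_triangle_ineq4]])
    also have "\<dots> \<le> N (D n) * N (E n) + N f * N (E n) + N (D n) * N h"
      by (intro add_mono CS D E f h)
    finally show ?thesis .
  qed
  have "(\<lambda>n. N (D n) * N (E n) + N f * N (E n) + N (D n) * N h) \<longlonglongrightarrow> 0 * 0 + N f * 0 + 0 * N h"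
    by (intro tendsto_intros ND NE)
  then have "(\<lambda>n. (LINT x|M. F n x * cnj (H n x)) - (LINT x|M. f x * cnj (h x))) \<longlonglongrightarrow> 0"
    by (intro Lim_null_comparison[OF always_eventually[OF allI[OF bound]]]) simp
  then show ?thesis by (simp add: LIM_zero_iff)
qed

text \<open>A single member of the sequence at finite distance suffices, because
  \<open>f = (f - F n) + F n\<close>.\<close>

lemma square_int_limit:
  assumes F: "\<And>n. square_int M (F n)" and f: "f \<in> borel_measurable M"
    and Ff: "(\<lambda>n. \<integral>\<^sup>+x. ennreal ((cmod (f x - F n x))\<^sup>2) \<partial>M) \<longlonglongrightarrow> 0"
  shows "square_int M f"
proof -
  have "\<forall>\<^sub>F n in sequentially. (\<integral>\<^sup>+x. ennreal ((cmod (f x - F n x))\<^sup>2) \<partial>M) < 1"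
    using order_tendstoD(2)[OF Ff, of 1] by simp
  then obtain n where "(\<integral>\<^sup>+x. ennreal ((cmod (f x - F n x))\<^sup>2) \<partial>M) < 1"
    by (auto simp: eventually_sequentially)
  also have "(1::ennreal) < \<infinity>" by simp
  finally have "square_int M (\<lambda>x. f x - F n x)"
    using F[of n] f by (auto simp: square_int_iff_nn_integral)
  from square_int_add[OF this F[of n]] show ?thesis by simp
qed

text \<open>The Riesz-Fischer argument for a sequence that already converges fast. On a probability
  space the L^1 norm is at most the L^2 norm, so consecutive increments have L^1 norm at most
  \<open>(1/2)^n\<close>; they are therefore summable almost surely, and the sequence converges
  almost surely.\<close>

lemma (in prob_space) square_int_complete:
  fixes Y :: "nat \<Rightarrow> 'a \<Rightarrow> complex"
  assumes Y: "\<And>n. square_int M (Y n)"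
    and cauchy: "\<And>m n. n \<le> m \<Longrightarrow> (\<integral>\<^sup>+x. ennreal ((cmod (Y m x - Y n x))\<^sup>2) \<partial>M) \<le> ennreal ((1/4)^n)"
  shows "\<exists>X\<in>borel_measurable M. (\<lambda>n. \<integral>\<^sup>+x. ennreal ((cmod (X x - Y n x))\<^sup>2) \<partial>M) \<longlonglongrightarrow> 0"
proof -
  have [measurable]: "Y n \<in> borel_measurable M" for n
    using Y by (auto simp: square_int_def)
  \<comment> \<open>Where the sequence diverges \<open>lim\<close> has an unspecified value; this
    turns out to happen on a null set only.\<close>
  define X where "X x = lim (\<lambda>n. Y n x)" for x
  have X[measurable]: "X \<in> borel_measurable M"
    unfolding X_def[abs_def] by measurable
  have L1: "(\<integral>\<^sup>+x. ennreal (cmod (Y (Suc n) x - Y n x)) \<partial>M) \<le> ennreal ((1/2)^n)" for n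
  proof -
    have "(\<integral>\<^sup>+x. ennreal (cmod (Y (Suc n) x - Y n x)) * 1 \<partial>M)\<^sup>2 \<le>
      (\<integral>\<^sup>+x. (ennreal (cmod (Y (Suc n) x - Y n x)))\<^sup>2 \<partial>M) * (\<integral>\<^sup>+x. 1\<^sup>2 \<partial>M)"
      by (rule Cauchy_Schwarz_nn_integral) auto
    also have "\<dots> \<le> ennreal ((1/4)^n)"
      using cauchy[of n "Suc n"] by (simp add: ennreal_power emeasure_space_1)
    also have "\<dots> = (ennreal ((1/2)^n))\<^sup>2"
    proof -
      have "((1/2::real)^n)\<^sup>2 = (1/4)^n"
        by (simp add: power2_eq_square flip: power_mult_distrib)
      then show ?thesis by (simp add: ennreal_power)
    qed
    finally have le: "(\<integral>\<^sup>+x. ennreal (cmod (Y (Suc n) x - Y n x)) \<partial>M)\<^sup>2 \<le> (ennreal ((1/2)^n))\<^sup>2"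
      by simp
    show ?thesis
    proof (cases "\<integral>\<^sup>+x. ennreal (cmod (Y (Suc n) x - Y n x)) \<partial>M")
      case (real r)
      with le have "r\<^sup>2 \<le> ((1/2)^n)\<^sup>2" by (simp add: ennreal_power)
      then have "r \<le> (1/2)^n" by (rule power2_le_imp_le) simp
      with real show ?thesis by (simp add: ennreal_leI)
    next
      case top
      with le show ?thesis by (simp add: ennreal_power top_unique)
    qed
  qed
  have "(\<integral>\<^sup>+x. (\<Sum>n. ennreal (cmod (Y (Suc n) x - Y n x))) \<partial>M) =
      (\<Sum>n. \<integral>\<^sup>+x. ennreal (cmod (Y (Suc n) x - Y n x)) \<partial>M)"
    by (rule nn_integral_suminf) auto
  also have "\<dots> \<le> (\<Sum>n. ennreal ((1/2)^n))"
    by (intro suminf_le L1) auto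
  also have "\<dots> = ennreal (\<Sum>n. (1/2)^n)"
    by (rule suminf_ennreal2) auto
  also have "\<dots> < \<infinity>" by simp
  finally have "AE x in M. (\<Sum>n. ennreal (cmod (Y (Suc n) x - Y n x))) \<noteq> \<infinity>"
    by (intro nn_integral_noteq_infinite) auto
  then have lim: "AE x in M. (\<lambda>n. Y n x) \<longlonglongrightarrow> X x"
  proof eventually_elim
    case (elim x)
    have "summable (\<lambda>n. cmod (Y (Suc n) x - Y n x))"
      by (rule summable_suminf_not_top) (use elim in auto)
    then have "summable (\<lambda>n. Y (Suc n) x - Y n x)"
      by (rule summable_norm_cancel)
    then have "convergent (\<lambda>n. \<Sum>i<n. Y (Suc i) x - Y i x)"
      by (simp add: summable_iff_convergent)
    then have "convergent (\<lambda>n. Y n x - Y 0 x)"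
      by (simp only: sum_lessThan_telescope[of "\<lambda>n. Y n x"])
    from convergent_add[OF this convergent_const[of "Y 0 x"]]
    have "convergent (\<lambda>n. Y n x)"
      by simp
    then show ?case by (simp add: X_def convergent_LIMSEQ_iff)
  qed
  \<comment> \<open>Fatou's lemma in \<open>m\<close>, with \<open>n\<close> fixed, turns the Cauchy
    estimate into a rate for the limit.\<close>
  have bound: "(\<integral>\<^sup>+x. ennreal ((cmod (X x - Y n x))\<^sup>2) \<partial>M) \<le> ennreal ((1/4)^n)" for n
  proof -
    have "(\<integral>\<^sup>+x. ennreal ((cmod (X x - Y n x))\<^sup>2) \<partial>M) =
      (\<integral>\<^sup>+x. liminf (\<lambda>m. ennreal ((cmod (Y m x - Y n x))\<^sup>2)) \<partial>M)"
      using lim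
    proof (intro nn_integral_cong_AE, eventually_elim)
      case (elim x)
      then have "(\<lambda>m. ennreal ((cmod (Y m x - Y n x))\<^sup>2)) \<longlonglongrightarrow> ennreal ((cmod (X x - Y n x))\<^sup>2)"
        by (intro tendsto_intros)
      from lim_imp_Liminf[OF _ this] show ?case by simp
    qed
    also have "\<dots> \<le> liminf (\<lambda>m. \<integral>\<^sup>+x. ennreal ((cmod (Y m x - Y n x))\<^sup>2) \<partial>M)"
      by (rule nn_integral_liminf) auto
    also have "\<dots> \<le> ennreal ((1/4)^n)"
      by (intro Liminf_le eventually_sequentiallyI[of n] cauchy) auto
    finally show ?thesis .
  qed
  have "(\<lambda>n. (1/4::real)^n) \<longlonglongrightarrow> 0"
    by (intro LIMSEQ_realpow_zero) auto
  then have z: "(\<lambda>n. ennreal ((1/4)^n)) \<longlonglongrightarrow> 0"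
    by (simp add: tendsto_ennreal_iff flip: ennreal_0)
  have "(\<lambda>n. \<integral>\<^sup>+x. ennreal ((cmod (X x - Y n x))\<^sup>2) \<partial>M) \<longlonglongrightarrow> 0"
    by (rule tendsto_sandwich[OF _ _ tendsto_const z]) (use bound in auto)
  with X show ?thesis by blast
qed

section \<open>Density of step functions\<close>

lemma step_fun_append: "step_fun (S @ T) y = step_fun S y + step_fun T y"
  by (simp add: step_fun_def)

lemma step_fun_scale: "step_fun (map (\<lambda>(c, r). (b * c, r)) S) y = b * step_fun S y"
  by (induction S) (auto simp: step_fun_def algebra_simps)

lemma borel_measurable_step_fun [measurable]: "step_fun S \<in> borel_measurable lebesgue"
proof (induction S)
  case Nil
  then show ?case by (simp add: step_fun_def[abs_def])
next
  case (Cons x S)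
  obtain c s t where x: "x = (c, s, t)" by (cases x)
  have "step_fun (x # S) = (\<lambda>y. indicator (cbox s t) y * c + step_fun S y)"
    by (auto simp: step_fun_def x)
  moreover have "(indicator (cbox s t) :: _ \<Rightarrow> complex) \<in> borel_measurable lebesgue"
    by (intro borel_measurable_indicator) simp
  ultimately show ?case using Cons by simp
qed

definition step_approximable :: "(real^2 \<Rightarrow> complex) \<Rightarrow> bool" where
  "step_approximable f \<longleftrightarrow> f \<in> borel_measurable lebesgue \<and>
     (\<forall>e>0. \<exists>S. proper_steps S \<and>
        (\<integral>\<^sup>+y. ennreal ((cmod (f y - step_fun S y))\<^sup>2) \<partial>lebesgue) < ennreal e)"

text \<open>Serves the passage from Borel to Lebesgue measurable sets, which agree only up to null
  sets.\<close>

lemma step_approximable_cong_AE: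
  assumes f: "step_approximable f" and g: "g \<in> borel_measurable lebesgue"
    and eq: "AE y in lebesgue. f y = g y"
  shows "step_approximable g"
proof -
  have "(\<integral>\<^sup>+y. ennreal ((cmod (g y - step_fun S y))\<^sup>2) \<partial>lebesgue) =
     (\<integral>\<^sup>+y. ennreal ((cmod (f y - step_fun S y))\<^sup>2) \<partial>lebesgue)" for S
    using eq by (intro nn_integral_cong_AE, eventually_elim) auto
  with f g show ?thesis by (simp add: step_approximable_def)
qed

text \<open>Quarters of the tolerance compensate for the factor 2 in the triangle inequality for
  squared norms.\<close>

lemma ennreal_double_add_less:
  assumes "A < ennreal (e/4)" "B < ennreal (e/4)"
  shows "2 * A + 2 * B < ennreal e"
proof -
  have e: "0 < e"
  proof (rule ccontr)
    assume "\<not> 0 < e"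
    then have "ennreal (e/4) = 0" by (simp add: ennreal_neg)
    with assms(1) show False by simp
  qed
  have "A < \<infinity>" "B < \<infinity>"
    using assms ennreal_less_top[of "e/4"] by (auto intro: less_trans)
  then obtain a b where ab: "A = ennreal a" "0 \<le> a" "B = ennreal b" "0 \<le> b"
    by (cases A; cases B) auto
  with assms have "a < e/4" "b < e/4" by (simp_all add: ennreal_less_iff)
  then have "ennreal (2 * a + 2 * b) < ennreal e"
    using ab e by (subst ennreal_less_iff) auto
  then show ?thesis
    using ab by (simp add: ennreal_plus ennreal_mult')
qed

lemma step_approximable_add:
  assumes f: "step_approximable f" and g: "step_approximable g"
  shows "step_approximable (\<lambda>y. f y + g y)"
  unfolding step_approximable_def
proof (intro conjI allI impI)
  have [measurable]: "f \<in> borel_measurable lebesgue" "g \<in> borel_measurable lebesgue"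
    using f g by (auto simp: step_approximable_def)
  show "(\<lambda>y. f y + g y) \<in> borel_measurable lebesgue" by simp
  fix e :: real assume "e > 0"
  then have "e / 4 > 0" by simp
  then obtain S T where S: "proper_steps S" "(\<integral>\<^sup>+y. ennreal ((cmod (f y - step_fun S y))\<^sup>2) \<partial>lebesgue) < ennreal (e/4)"
    and T: "proper_steps T" "(\<integral>\<^sup>+y. ennreal ((cmod (g y - step_fun T y))\<^sup>2) \<partial>lebesgue) < ennreal (e/4)"
    using f g unfolding step_approximable_def by meson
  have "(\<integral>\<^sup>+y. ennreal ((cmod (f y + g y - step_fun (S @ T) y))\<^sup>2) \<partial>lebesgue) =
      (\<integral>\<^sup>+y. ennreal ((cmod ((f y - step_fun S y) + (g y - step_fun T y)))\<^sup>2) \<partial>lebesgue)"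
    by (simp add: step_fun_append algebra_simps)
  also have "\<dots> \<le> 2 * (\<integral>\<^sup>+y. ennreal ((cmod (f y - step_fun S y))\<^sup>2) \<partial>lebesgue) +
      2 * (\<integral>\<^sup>+y. ennreal ((cmod (g y - step_fun T y))\<^sup>2) \<partial>lebesgue)"
    by (rule nn_integral_cmod_add_square_le) auto
  also have "\<dots> < ennreal e"
    by (rule ennreal_double_add_less[OF S(2) T(2)])
  finally show "\<exists>S. proper_steps S \<and>
      (\<integral>\<^sup>+y. ennreal ((cmod (f y + g y - step_fun S y))\<^sup>2) \<partial>lebesgue) < ennreal e"
    using S(1) T(1) by (intro exI[of _ "S @ T"]) (auto simp: proper_steps_def)
qed

lemma step_approximable_cmult:
  assumes f: "step_approximable f"
  shows "step_approximable (\<lambda>y. b * f y)"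
  unfolding step_approximable_def
proof (intro conjI allI impI)
  have [measurable]: "f \<in> borel_measurable lebesgue"
    using f by (auto simp: step_approximable_def)
  show "(\<lambda>y. b * f y) \<in> borel_measurable lebesgue" by simp
  fix e :: real assume e: "e > 0"
  \<comment> \<open>The summand 1 keeps the divisor positive when \<open>b = 0\<close> and makes the
    final inequality strict.\<close>
  define C where "C = (cmod b)\<^sup>2 + 1"
  have C: "C > 0" by (simp add: C_def add_nonneg_pos)
  with e have "e / C > 0" by simp
  then obtain S where S: "proper_steps S" "(\<integral>\<^sup>+y. ennreal ((cmod (f y - step_fun S y))\<^sup>2) \<partial>lebesgue) < ennreal (e / C)"
    using f unfolding step_approximable_def by meson
  let ?T = "map (\<lambda>(c, r). (b * c, r)) S"
  have "(\<integral>\<^sup>+y. ennreal ((cmod (b * f y - step_fun ?T y))\<^sup>2) \<partial>lebesgue) =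
      (\<integral>\<^sup>+y. ennreal ((cmod b)\<^sup>2) * ennreal ((cmod (f y - step_fun S y))\<^sup>2) \<partial>lebesgue)"
    by (simp add: step_fun_scale right_diff_distrib[symmetric] norm_mult power_mult_distrib ennreal_mult')
  also have "\<dots> = ennreal ((cmod b)\<^sup>2) * (\<integral>\<^sup>+y. ennreal ((cmod (f y - step_fun S y))\<^sup>2) \<partial>lebesgue)"
    by (simp add: nn_integral_cmult)
  also have "\<dots> \<le> ennreal ((cmod b)\<^sup>2) * ennreal (e / C)"
    using S(2) by (intro mult_left_mono) auto
  also have "\<dots> = ennreal ((cmod b)\<^sup>2 * (e / C))"
    using C e by (intro ennreal_mult[symmetric]) auto
  also have "\<dots> < ennreal e"
  proof -
    have "(cmod b)\<^sup>2 * e < e * C" using e by (simp add: C_def algebra_simps)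
    then have "(cmod b)\<^sup>2 * (e / C) < e" using C by (simp add: field_simps)
    then show ?thesis using e C by (subst ennreal_less_iff) auto
  qed
  finally show "\<exists>S. proper_steps S \<and>
      (\<integral>\<^sup>+y. ennreal ((cmod (b * f y - step_fun S y))\<^sup>2) \<partial>lebesgue) < ennreal e"
    using S(1) by (intro exI[of _ ?T]) (auto simp: proper_steps_def)
qed

lemma step_approximable_zero: "step_approximable (\<lambda>_. 0)"
  unfolding step_approximable_def
proof (intro conjI allI impI)
  fix e :: real assume "e > 0"
  then show "\<exists>S. proper_steps S \<and> (\<integral>\<^sup>+y. ennreal ((cmod (0 - step_fun S y))\<^sup>2) \<partial>lebesgue) < ennreal e"
    by (intro exI[of _ "[]"]) (auto simp: proper_steps_def step_fun_def)
qed simp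

lemma step_approximable_sum:
  assumes "\<And>i. i \<in> I \<Longrightarrow> step_approximable (f i)"
  shows "step_approximable (\<lambda>y. \<Sum>i\<in>I. f i y)"
  using assms
proof (induction I rule: infinite_finite_induct)
  case (insert x F)
  then show ?case by (auto intro: step_approximable_add)
qed (auto simp: step_approximable_zero)

text \<open>The closure property that drives the density proof, used both for countable unions of
  sets and for limits of simple functions. Dominated convergence, with majorant
  \<open>4 * (g y)\<^sup>2\<close>, brings some \<open>F n\<close> close to \<open>f\<close> in the
  mean square, and \<open>F n\<close> is in turn close to a step function.\<close>

lemma step_approximable_dominated_limit:
  fixes F :: "nat \<Rightarrow> real^2 \<Rightarrow> complex"
  assumes F: "\<And>n. step_approximable (F n)" and f: "f \<in> borel_measurable lebesgue"
    and lim: "\<And>y. (\<lambda>n. F n y) \<longlonglongrightarrow> f y"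
    and bound: "\<And>n y. cmod (F n y) \<le> g y"
    and g: "g \<in> borel_measurable lebesgue" "(\<integral>\<^sup>+y. ennreal ((g y)\<^sup>2) \<partial>lebesgue) < \<infinity>"
  shows "step_approximable f"
  unfolding step_approximable_def
proof (intro conjI allI impI f)
  note [measurable] = f g(1)
  have [measurable]: "F n \<in> borel_measurable lebesgue" for n
    using F by (auto simp: step_approximable_def)
  fix e :: real assume e: "e > 0"
  have fg: "cmod (f y) \<le> g y" for y
    by (rule LIMSEQ_le_const2[OF tendsto_norm[OF lim]]) (use bound in auto)
  have "(\<lambda>n. \<integral>\<^sup>+y. ennreal ((cmod (f y - F n y))\<^sup>2) \<partial>lebesgue) \<longlonglongrightarrow> (\<integral>\<^sup>+y. 0 \<partial>(lebesgue :: (real^2) measure))"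
  proof (rule nn_integral_dominated_convergence[where w = "\<lambda>y. 4 * ennreal ((g y)\<^sup>2)"])
    show "AE y in lebesgue. ennreal ((cmod (f y - F n y))\<^sup>2) \<le> 4 * ennreal ((g y)\<^sup>2)" for n
    proof (rule AE_I2)
      fix y
      have "cmod (f y - F n y) \<le> 2 * g y"
        using norm_triangle_ineq4[of "f y" "F n y"] fg[of y] bound[of n y] by linarith
      then have "(cmod (f y - F n y))\<^sup>2 \<le> (2 * g y)\<^sup>2"
        by (intro power_mono) auto
      then have "ennreal ((cmod (f y - F n y))\<^sup>2) \<le> ennreal (4 * (g y)\<^sup>2)"
        by (intro ennreal_leI) (simp add: power_mult_distrib)
      then show "ennreal ((cmod (f y - F n y))\<^sup>2) \<le> 4 * ennreal ((g y)\<^sup>2)"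
        by (simp add: ennreal_mult')
    qed
    show "(\<integral>\<^sup>+y. 4 * ennreal ((g y)\<^sup>2) \<partial>lebesgue) < \<infinity>"
      using g by (simp add: nn_integral_cmult ennreal_mult_less_top)
    show "AE y in lebesgue. (\<lambda>n. ennreal ((cmod (f y - F n y))\<^sup>2)) \<longlonglongrightarrow> 0"
    proof (rule AE_I2)
      fix y
      have "(\<lambda>n. (cmod (f y - F n y))\<^sup>2) \<longlonglongrightarrow> (cmod (f y - f y))\<^sup>2"
        by (intro tendsto_intros lim)
      then show "(\<lambda>n. ennreal ((cmod (f y - F n y))\<^sup>2)) \<longlonglongrightarrow> 0"
        by (simp add: tendsto_ennreal_iff flip: ennreal_0)
    qed
  qed auto
  then have "(\<lambda>n. \<integral>\<^sup>+y. ennreal ((cmod (f y - F n y))\<^sup>2) \<partial>lebesgue) \<longlonglongrightarrow> 0" by simp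
  then have "\<forall>\<^sub>F n in sequentially. (\<integral>\<^sup>+y. ennreal ((cmod (f y - F n y))\<^sup>2) \<partial>lebesgue) < ennreal (e/4)"
    using e by (intro order_tendstoD(2)) auto
  then obtain n where n: "(\<integral>\<^sup>+y. ennreal ((cmod (f y - F n y))\<^sup>2) \<partial>lebesgue) < ennreal (e/4)"
    by (auto simp: eventually_sequentially)
  obtain S where S: "proper_steps S" "(\<integral>\<^sup>+y. ennreal ((cmod (F n y - step_fun S y))\<^sup>2) \<partial>lebesgue) < ennreal (e/4)"
    using F[of n] e unfolding step_approximable_def by (meson divide_pos_pos zero_less_numeral)
  have "(\<integral>\<^sup>+y. ennreal ((cmod (f y - step_fun S y))\<^sup>2) \<partial>lebesgue) =
      (\<integral>\<^sup>+y. ennreal ((cmod ((f y - F n y) + (F n y - step_fun S y)))\<^sup>2) \<partial>lebesgue)"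
    by simp
  also have "\<dots> \<le> 2 * (\<integral>\<^sup>+y. ennreal ((cmod (f y - F n y))\<^sup>2) \<partial>lebesgue) +
      2 * (\<integral>\<^sup>+y. ennreal ((cmod (F n y - step_fun S y))\<^sup>2) \<partial>lebesgue)"
    by (rule nn_integral_cmod_add_square_le) auto
  also have "\<dots> < ennreal e"
    by (rule ennreal_double_add_less[OF n S(2)])
  finally show "\<exists>S. proper_steps S \<and>
      (\<integral>\<^sup>+y. ennreal ((cmod (f y - step_fun S y))\<^sup>2) \<partial>lebesgue) < ennreal e"
    using S(1) by auto
qed

text \<open>The corners of an empty box may be out of order, which \<open>proper_steps\<close>
  forbids; that case is covered by the zero function instead.\<close>

lemma step_approximable_indicator_cbox: "step_approximable (indicator (cbox s t))"
proof (cases "cbox s t = {}")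
  case True
  then show ?thesis using step_approximable_zero by (simp add: indicator_def[abs_def])
next
  case False
  then have "s \<le> t"
    by (auto simp: mem_box_cart less_eq_vec_def) (meson order_trans)
  show ?thesis
    unfolding step_approximable_def
  proof (intro conjI allI impI)
    fix e :: real assume "e > 0"
    then show "\<exists>S. proper_steps S \<and>
        (\<integral>\<^sup>+y. ennreal ((cmod (indicator (cbox s t) y - step_fun S y))\<^sup>2) \<partial>lebesgue) < ennreal e"
      using \<open>s \<le> t\<close> by (intro exI[of _ "[(1, s, t)]"]) (auto simp: proper_steps_def step_fun_def)
  qed (intro borel_measurable_indicator, simp)
qed

lemma cbox_Int_cbox: "\<exists>u v. cbox s t \<inter> cbox p q = (cbox u v :: (real^2) set)"
  unfolding Int_interval by blast

text \<open>Dynkin's argument: boxes are stable under intersection and generate the Borel sets.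
  Cutting every set with a fixed box keeps all measures finite, so that a complement becomes a
  difference of two square-integrable indicators and a disjoint union is a limit of finite unions
  dominated by the indicator of the box.\<close>

lemma step_approximable_indicator_borel:
  assumes A: "A \<in> sets (borel :: (real^2) measure)"
  shows "step_approximable (indicator (A \<inter> cbox p q))"
proof -
  let ?G = "range (\<lambda>(s, t). {s..t::real^2})"
  have gen: "A \<in> sigma_sets UNIV ?G"
    using A unfolding borel_eq_atLeastAtMost by simp
  have "Int_stable ?G"
  proof (rule Int_stableI)
    fix a b assume "a \<in> ?G" "b \<in> ?G"
    then obtain s t p q where "a = cbox s t" "b = cbox p q"
      by (auto simp: interval_cbox_cart)
    moreover obtain u v where "cbox s t \<inter> cbox p q = cbox u v"
      using cbox_Int_cbox by blast
    ultimately show "a \<inter> b \<in> ?G"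
      by (auto simp: interval_cbox_cart)
  qed
  moreover have "?G \<subseteq> Pow UNIV" by simp
  moreover note gen
  ultimately show ?thesis
  proof (induction A rule: sigma_sets_induct_disjoint)
    case (basic A)
    then obtain s t where "A = cbox s t" by (auto simp: interval_cbox_cart)
    then show ?case by (metis cbox_Int_cbox step_approximable_indicator_cbox)
  next
    case empty
    then show ?case using step_approximable_zero by (simp add: indicator_def[abs_def])
  next
    case (compl A)
    have "(indicator ((UNIV - A) \<inter> cbox p q) :: real^2 \<Rightarrow> complex) =
        (\<lambda>y. indicator (cbox p q) y + (-1) * indicator (A \<inter> cbox p q) y)"
      by (auto simp: fun_eq_iff indicator_def)
    then show ?case
      using step_approximable_add[OF step_approximable_indicator_cbox[of p q]
          step_approximable_cmult[OF compl(2), of "-1"]] by simp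
  next
    case (union A)
    have [measurable]: "A i \<in> sets borel" for i
      using union(2) unfolding borel_eq_atLeastAtMost by auto
    have approx: "step_approximable (indicator (\<Union>i<n. A i \<inter> cbox p q))" for n
    proof (induction n)
      case 0
      then show ?case using step_approximable_zero by (simp add: indicator_def[abs_def])
    next
      case (Suc n)
      have "(indicator (\<Union>i<Suc n. A i \<inter> cbox p q) :: real^2 \<Rightarrow> complex) =
        (\<lambda>y. indicator (\<Union>i<n. A i \<inter> cbox p q) y + indicator (A n \<inter> cbox p q) y)"
      proof
        fix y
        have "\<not> (y \<in> A n \<and> (\<exists>i<n. y \<in> A i))"
          using union(1) unfolding disjoint_family_on_def by (metis IntI UNIV_I empty_iff less_irrefl)
        then show "(indicator (\<Union>i<Suc n. A i \<inter> cbox p q) y :: complex) =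
            indicator (\<Union>i<n. A i \<inter> cbox p q) y + indicator (A n \<inter> cbox p q) y"
          by (auto simp: indicator_def less_Suc_eq)
      qed
      then show ?case using step_approximable_add[OF Suc union(3)[of n]] by simp
    qed
    have eq: "(\<Union>i. A i) \<inter> cbox p q = (\<Union>i. A i \<inter> cbox p q)" by auto
    show ?case
      unfolding eq
    proof (rule step_approximable_dominated_limit[OF approx, where g = "indicator (cbox p q)"])
      show "(indicator (\<Union>i. A i \<inter> cbox p q) :: _ \<Rightarrow> complex) \<in> borel_measurable lebesgue"
        by (intro borel_measurable_indicator sets.countable_UN) auto
      show "(indicator (cbox p q) :: _ \<Rightarrow> real) \<in> borel_measurable lebesgue"
        by (intro borel_measurable_indicator) simp
      show "(\<lambda>n. indicator (\<Union>i<n. A i \<inter> cbox p q) y :: complex) \<longlonglongrightarrow> indicator (\<Union>i. A i \<inter> cbox p q) y" for y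
        by (rule LIMSEQ_indicator_UN)
      show "(\<integral>\<^sup>+ y. ennreal ((indicator (cbox p q) y)\<^sup>2) \<partial>lebesgue) < \<infinity>"
      proof -
        have "(\<integral>\<^sup>+ y. ennreal ((indicator (cbox p q) y)\<^sup>2) \<partial>lebesgue) = 
          (\<integral>\<^sup>+ y. indicator (cbox p q) y \<partial>lebesgue)"
          by (intro nn_integral_cong) (auto simp: indicator_def)
        then show ?thesis by (simp add: emeasure_lborel_cbox_eq)
      qed
    qed (auto simp: indicator_def)
  qed
qed

text \<open>A Lebesgue measurable set is a Borel set together with a subset of a null set, and null
  sets do not affect the mean-square distance.\<close>

lemma step_approximable_indicator_lebesgue:
  assumes A: "A \<in> sets lebesgue"
  shows "step_approximable (indicator (A \<inter> cbox p q))"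
proof -
  obtain S N N' where *: "A = S \<union> N" "N \<subseteq> N'" "N' \<in> null_sets lborel" "S \<in> sets lborel"
    using A by (rule sets_completionE)
  have "N' \<in> null_sets lebesgue"
    using *(3) by (rule null_sets_completionI)
  then have "AE y in lebesgue. y \<notin> N'" by (rule AE_not_in)
  then have "AE y in lebesgue. (indicator (S \<inter> cbox p q) y :: complex) = indicator (A \<inter> cbox p q) y"
    by eventually_elim (use * in \<open>auto simp: indicator_def\<close>)
  then show ?thesis
    using A *(4) by (intro step_approximable_cong_AE[OF step_approximable_indicator_borel[of S p q]]
      borel_measurable_indicator sets.Int) auto
qed

text \<open>Simple functions dominated by \<open>2 * cmod (f y)\<close> converge to
  \<open>f\<close>; each is a finite combination of indicators of its level sets.\<close>

lemma step_approximable_square_int: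
  assumes f: "square_int lebesgue f" and supp: "\<And>y. y \<notin> cbox p q \<Longrightarrow> f y = 0"
  shows "step_approximable f"
proof -
  note [measurable] = square_intD(1)[OF f]
  obtain F where F: "\<And>i. simple_function lebesgue (F i)" "\<And>y. (\<lambda>i. F i y) \<longlonglongrightarrow> f y"
    and Fb: "\<And>i y. cmod (F i y) \<le> 2 * cmod (f y)"
    using borel_measurable_implies_sequence_metric[OF square_intD(1)[OF f], of 0]
    by (auto simp: dist_norm)
  have approx: "step_approximable (F i)" for i
  proof -
    have fin: "finite (range (F i))"
      using simple_functionD(1)[OF F(1)[of i]] by simp
    have "F i = (\<lambda>y. \<Sum>z\<in>range (F i). z * indicator (F i -` {z} \<inter> cbox p q) y)"
    proof
      fix y
      have "(\<Sum>z\<in>range (F i). z * indicator (F i -` {z} \<inter> cbox p q) y) =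
          (\<Sum>z\<in>range (F i). if z = F i y then F i y * indicator (cbox p q) y else 0)"
        by (rule sum.cong) (auto simp: indicator_def)
      also have "\<dots> = F i y * indicator (cbox p q) y"
        using fin by simp
      \<comment> \<open>Outside the box \<open>f\<close> vanishes, and the bound by
        \<open>2 * cmod (f y)\<close> then forces \<open>F i y = 0\<close>; this is what allows the
        level sets to be cut with the box.\<close>
      also have "\<dots> = F i y"
        using supp[of y] Fb[of i y] by (auto simp: indicator_def)
      finally show "F i y = (\<Sum>z\<in>range (F i). z * indicator (F i -` {z} \<inter> cbox p q) y)" ..
    qed
    moreover have "step_approximable (\<lambda>y. \<Sum>z\<in>range (F i). z * indicator (F i -` {z} \<inter> cbox p q) y)"
      using simple_functionD(2)[OF F(1)[of i]]
      by (intro step_approximable_sum step_approximable_cmult step_approximable_indicator_lebesgue) auto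
    ultimately show ?thesis by simp
  qed
  show ?thesis
  proof (rule step_approximable_dominated_limit[OF approx _ F(2) Fb])
    have "(\<integral>\<^sup>+ y. ennreal ((2 * cmod (f y))\<^sup>2) \<partial>lebesgue) = 4 * (\<integral>\<^sup>+ y. ennreal ((cmod (f y))\<^sup>2) \<partial>lebesgue)"
      by (simp add: power_mult_distrib ennreal_mult' nn_integral_cmult)
    also have "\<dots> < \<infinity>"
      using f by (auto simp: square_int_iff_nn_integral ennreal_mult_less_top)
    finally show "(\<integral>\<^sup>+ y. ennreal ((2 * cmod (f y))\<^sup>2) \<partial>lebesgue) < \<infinity>" .
  qed auto
qed

section \<open>Wiener integrals\<close>

text \<open>The degenerate law has no density and is treated apart; otherwise the moments are those
  of the normal density.\<close>

lemma centered_gaussian_moments: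
  assumes "prob_space M" and X: "centered_gaussian M X"
  shows "X \<in> borel_measurable M" "integrable M X" "integrable M (\<lambda>w. (X w)\<^sup>2)" "(LINT w|M. X w) = 0"
proof -
  interpret prob_space M by fact
  show m[measurable]: "X \<in> borel_measurable M" using X by (simp add: centered_gaussian_def)
  have "integrable M X \<and> integrable M (\<lambda>w. (X w)\<^sup>2) \<and> (LINT w|M. X w) = 0"
  proof (cases "AE w in M. X w = 0")
    case True
    then have "AE w in M. (X w)\<^sup>2 = 0" by eventually_elim simp
    then have "integrable M (\<lambda>w. (X w)\<^sup>2) \<longleftrightarrow> integrable M (\<lambda>w. 0 :: real)"
      by (intro integrable_cong_AE) auto
    moreover have "integrable M X \<longleftrightarrow> integrable M (\<lambda>w. 0 :: real)"
      using True by (intro integrable_cong_AE) auto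
    moreover have "(LINT w|M. X w) = (LINT w|M. 0)"
      using True by (intro integral_cong_AE) auto
    ultimately show ?thesis by simp
  next
    case False
    then obtain s where s: "s > 0" and D: "distributed M lborel X (normal_density 0 s)"
      using X by (auto simp: centered_gaussian_def)
    have "integrable M X"
      using distributed_integrable_var[OF D] integrable_normal_moment_nz_1[OF s, of 0] by simp
    moreover have "integrable M (\<lambda>w. (X w)\<^sup>2)"
    proof -
      have "integrable lborel (\<lambda>x. normal_density 0 s x * x\<^sup>2) \<longleftrightarrow> integrable M (\<lambda>w. (X w)\<^sup>2)"
        by (rule distributed_integrable[OF D]) auto
      then show ?thesis using integrable_normal_moment[OF s, of 0 2] by simp
    qed
    ultimately show ?thesis
      using normal_distributed_expectation[OF s D] by simp
  qed
  then show "integrable M X" "integrable M (\<lambda>w. (X w)\<^sup>2)" "(LINT w|M. X w) = 0" by auto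
qed

lemma brownian_sheet_moments:
  assumes "prob_space M" and B: "brownian_sheet M B"
  shows "B x \<in> borel_measurable M" "integrable M (B x)" "integrable M (\<lambda>w. (B x w)\<^sup>2)" "(LINT w|M. B x w) = 0"
proof -
  have gauss: "finite A \<Longrightarrow> centered_gaussian M (\<lambda>w. \<Sum>y\<in>A. c y * B y w)" for A c
    using B by (simp add: brownian_sheet_def)
  have "centered_gaussian M (\<lambda>w. \<Sum>y\<in>{x}. 1 * B y w)"
    by (rule gauss) simp
  then have "centered_gaussian M (B x)" by simp
  from centered_gaussian_moments[OF assms(1) this]
  show "B x \<in> borel_measurable M" "integrable M (B x)" "integrable M (\<lambda>w. (B x w)\<^sup>2)" "(LINT w|M. B x w) = 0"
    by auto
qed

text \<open>In \<open>brownian_sheet\<close> the covariance is a bare integral, which by convention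
  is 0 for a nonintegrable product, so integrability has to be supplied. Within one component it
  follows from finite second moments; for distinct components independence gives it, and the zero
  means make the expectation vanish.\<close>

lemma brownian_sheet_pair_covariance:
  assumes W: "brownian_sheet_pair M W"
  shows "has_bochner_integral M (\<lambda>w. W i x w * W j y w) (of_bool (i = j) * sheet_covariance x y)"
proof -
  interpret prob_space M using W by (simp add: brownian_sheet_pair_def)
  have Wi: "brownian_sheet M (W i)" for i using W by (simp add: brownian_sheet_pair_def)
  note mom = brownian_sheet_moments[OF prob_space_axioms Wi]
  note [measurable] = mom(1)
  show ?thesis
  proof (cases "i = j")
    case True
    have "integrable M (\<lambda>w. W i x w * W i y w)"
    proof (rule Bochner_Integration.integrable_bound)
      show "integrable M (\<lambda>w. (W i x w)\<^sup>2 + (W i y w)\<^sup>2)"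
        by (intro Bochner_Integration.integrable_add mom)
      show "AE w in M. norm (W i x w * W i y w) \<le> norm ((W i x w)\<^sup>2 + (W i y w)\<^sup>2)"
      proof (rule AE_I2)
        fix w
        have "2 * (\<bar>W i x w\<bar> * \<bar>W i y w\<bar>) \<le> (W i x w)\<^sup>2 + (W i y w)\<^sup>2"
          using sum_squares_bound[of "\<bar>W i x w\<bar>" "\<bar>W i y w\<bar>"] by simp
        moreover have "0 \<le> \<bar>W i x w\<bar> * \<bar>W i y w\<bar>" by simp
        ultimately have "\<bar>W i x w\<bar> * \<bar>W i y w\<bar> \<le> (W i x w)\<^sup>2 + (W i y w)\<^sup>2" by linarith
        then show "norm (W i x w * W i y w) \<le> norm ((W i x w)\<^sup>2 + (W i y w)\<^sup>2)"
          by (simp add: abs_mult)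
      qed
    qed simp
    then show ?thesis
      using Wi[of i] True by (simp add: has_bochner_integral_iff brownian_sheet_def)
  next
    case False
    \<comment> \<open>Independence is assumed for whole component fields. Evaluating component
      \<open>i\<close> at \<open>x\<close> and the other one at \<open>y\<close> turns the product
      over the index type into the product of the two required values.\<close>
    define z where "z k = (if k = i then x else y)" for k
    have UN: "(UNIV :: 2 set) = {i, j}"
      using False exhaust_2[of i] exhaust_2[of j] by (auto simp: UNIV_2)
    have "indep_vars (\<lambda>k. borel) (\<lambda>k w. (\<lambda>f. f (z k)) (\<lambda>x. W k x w)) UNIV"
      by (rule indep_vars_compose2[where M' = "\<lambda>j. PiM UNIV (\<lambda>x. borel)"])
        (use W in \<open>auto simp: brownian_sheet_pair_def\<close>)
    then have ind: "indep_vars (\<lambda>k. borel) (\<lambda>k w. W k (z k) w) UNIV" by simp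
    have int: "integrable M (\<lambda>w. W k (z k) w)" for k
      by (rule mom(2))
    have "integrable M (\<lambda>w. \<Prod>k\<in>UNIV. W k (z k) w)"
      by (rule indep_vars_integrable[OF finite ind int])
    moreover have "(LINT w|M. (\<Prod>k\<in>UNIV. W k (z k) w)) = (\<Prod>k\<in>UNIV. LINT w|M. W k (z k) w)"
      by (rule indep_vars_lebesgue_integral[OF finite ind int])
    moreover have "(\<Prod>k\<in>UNIV. h k) = h i * h j" for h :: "2 \<Rightarrow> real"
      unfolding UN using False by simp
    ultimately show ?thesis
      using False by (simp add: has_bochner_integral_iff z_def mom)
  qed
qed

section \<open>The isometry for step functions\<close>

text \<open>The two-sided Brownian covariance is \<open>min x y\<close> plus a function of
  \<open>x\<close> alone plus a function of \<open>y\<close> alone. A mixed second difference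
  annihilates the last two, and that of \<open>min\<close> is the length of the overlap of the
  intervals from \<open>s\<close> to \<open>t\<close> and from \<open>s'\<close> to
  \<open>t'\<close>.\<close>

lemma covariance_overlap:
  fixes s t s' t' :: real
  assumes "s \<le> t" "s' \<le> t'"
  shows "(\<bar>t\<bar> + \<bar>t'\<bar> - \<bar>t - t'\<bar>) / 2 - (\<bar>s\<bar> + \<bar>t'\<bar> - \<bar>s - t'\<bar>) / 2
     - (\<bar>t\<bar> + \<bar>s'\<bar> - \<bar>t - s'\<bar>) / 2 + (\<bar>s\<bar> + \<bar>s'\<bar> - \<bar>s - s'\<bar>) / 2
     = max 0 (min t t' - max s s')"
proof -
  have *: "(\<bar>x\<bar> + \<bar>y\<bar> - \<bar>x - y\<bar>) / 2 = (\<bar>x\<bar> - x) / 2 + (\<bar>y\<bar> - y) / 2 + min x y" for x y :: real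
    by (simp add: min_def field_simps)
  have "min t t' - min s t' - min t s' + min s s' = max 0 (min t t' - max s s')"
    using assms by (cases "t \<le> t'"; cases "s \<le> t'"; cases "t \<le> s'"; cases "s \<le> s'") auto
  then show ?thesis unfolding * by argo
qed

lemma measure_cbox_Int:
  fixes s t s' t' :: "real^2"
  shows "measure lebesgue (cbox s t \<inter> cbox s' t') =
    (\<Prod>i\<in>UNIV. max 0 (min (t$i) (t'$i) - max (s$i) (s'$i)))"
proof -
  define u where "u = (\<chi> i. max (s$i) (s'$i))"
  define v where "v = (\<chi> i. min (t$i) (t'$i))"
  have eq: "cbox s t \<inter> cbox s' t' = cbox u v"
    using Int_interval_cart[of s t s' t'] unfolding interval_cbox_cart u_def v_def .
  show ?thesis
  proof (cases "cbox u v = {}")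
    case True
    then obtain i where "v$i < u$i" unfolding interval_eq_empty_cart by blast
    then have "max 0 (min (t$i) (t'$i) - max (s$i) (s'$i)) = 0" by (simp add: u_def v_def)
    then have "(\<Prod>i\<in>UNIV. max 0 (min (t$i) (t'$i) - max (s$i) (s'$i))) = 0"
      by (intro prod_zero) auto
    then show ?thesis unfolding eq True by simp
  next
    case False
    then have "u$i \<le> v$i" for i unfolding interval_ne_empty_cart by blast
    then have "max 0 (min (t$i) (t'$i) - max (s$i) (s'$i)) = v$i - u$i" for i
      by (simp add: u_def v_def max_def)
    then show ?thesis
      using content_cbox_cart[OF False] unfolding eq by (simp add: measure_completion)
  qed
qed

text \<open>A rectangle increment is a difference in each coordinate and the sheet covariance is a
  product over coordinates, so the sixteen terms factor into two one-dimensional mixed differences,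
  that is, into two overlap lengths.\<close>

lemma rect_increment_covariance:
  assumes cov: "\<And>x y. has_bochner_integral M (\<lambda>w. B x w * B' y w) (q * sheet_covariance x y)"
    and st: "s \<le> t" "s' \<le> t'"
  shows "has_bochner_integral M (\<lambda>w. rect_increment B s t w * rect_increment B' s' t' w)
     (q * measure lebesgue (cbox s t \<inter> cbox s' t'))"
proof -
  let ?K = sheet_covariance
  \<comment> \<open>\<open>q * K' x\<close> is the expectation of \<open>B x\<close> times the
    increment of \<open>B'\<close>; the increment in the first factor is taken afterwards.\<close>
  define K' where "K' x = ?K x t' - ?K x (vector [s'$1, t'$2]) - ?K x (vector [t'$1, s'$2]) + ?K x s'" for x
  have 1: "has_bochner_integral M (\<lambda>w. B x w * rect_increment B' s' t' w) (q * K' x)" for x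
    using has_bochner_integral_add[OF has_bochner_integral_diff[OF has_bochner_integral_diff[OF
      cov[of x t'] cov[of x "vector [s'$1, t'$2]"]] cov[of x "vector [t'$1, s'$2]"]] cov[of x s']]
    by (simp add: rect_increment_def K'_def algebra_simps)
  have 2: "has_bochner_integral M (\<lambda>w. rect_increment B s t w * rect_increment B' s' t' w)
     (q * (K' t - K' (vector [s$1, t$2]) - K' (vector [t$1, s$2]) + K' s))"
    using has_bochner_integral_add[OF has_bochner_integral_diff[OF has_bochner_integral_diff[OF
      1[of t] 1[of "vector [s$1, t$2]"]] 1[of "vector [t$1, s$2]"]] 1[of s]]
    by (simp add: rect_increment_def[of B] algebra_simps)
  define k :: "real \<Rightarrow> real \<Rightarrow> real" where "k u v = (\<bar>u\<bar> + \<bar>v\<bar> - \<bar>u - v\<bar>) / 2" for u v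
  have K: "?K x y = k (x$1) (y$1) * k (x$2) (y$2)" for x y
    by (simp add: sheet_covariance_def k_def UNIV_2)
  have "K' t - K' (vector [s$1, t$2]) - K' (vector [t$1, s$2]) + K' s =
    (k (t$1) (t'$1) - k (s$1) (t'$1) - k (t$1) (s'$1) + k (s$1) (s'$1)) *
    (k (t$2) (t'$2) - k (s$2) (t'$2) - k (t$2) (s'$2) + k (s$2) (s'$2))"
    by (simp add: K'_def K vector_2 algebra_simps)
  also have "\<dots> = (\<Prod>i\<in>UNIV. max 0 (min (t$i) (t'$i) - max (s$i) (s'$i)))"
    using st covariance_overlap[of "s$1" "t$1" "s'$1" "t'$1"] covariance_overlap[of "s$2" "t$2" "s'$2" "t'$2"]
    by (simp add: k_def UNIV_2 less_eq_vec_def)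
  finally show ?thesis using 2 by (simp add: measure_cbox_Int)
qed

text \<open>Both sides are sesquilinear in the step lists, so the claim reduces to pairs of
  rectangles, which may overlap within one list.\<close>

lemma step_isometry:
  assumes cov: "\<And>x y. has_bochner_integral M (\<lambda>w. B x w * B' y w) (q * sheet_covariance x y)"
    and S: "proper_steps S" and T: "proper_steps T"
  shows "has_bochner_integral M (\<lambda>w. step_integral B S w * cnj (step_integral B' T w))
     (of_real q * (LINT y|lebesgue. step_fun S y * cnj (step_fun T y)))"
proof -
  have rect: "has_bochner_integral lebesgue
       (\<lambda>y. (indicator (cbox s t) y * c) * cnj (indicator (cbox s' t') y * c'))
       (c * cnj c' * of_real (measure lebesgue (cbox s t \<inter> cbox s' t')))"
    "has_bochner_integral M
       (\<lambda>w. (c * of_real (rect_increment B s t w)) * cnj (c' * of_real (rect_increment B' s' t' w)))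
       (of_real q * (c * cnj c' * of_real (measure lebesgue (cbox s t \<inter> cbox s' t'))))"
    if "s \<le> t" "s' \<le> t'" for c c' s t s' t'
  proof -
    have "emeasure lebesgue (cbox s t \<inter> cbox s' t') < \<infinity>"
      using cbox_Int_cbox[of s t s' t'] by (auto simp: emeasure_lborel_cbox_eq)
    then have "has_bochner_integral lebesgue (\<lambda>y. indicator (cbox s t \<inter> cbox s' t') y *\<^sub>R (c * cnj c'))
       (measure lebesgue (cbox s t \<inter> cbox s' t') *\<^sub>R (c * cnj c'))"
      by (intro has_bochner_integral_indicator) auto
    moreover have "(\<lambda>y. indicator (cbox s t \<inter> cbox s' t') y *\<^sub>R (c * cnj c')) =
        (\<lambda>y. (indicator (cbox s t) y * c) * cnj (indicator (cbox s' t') y * c'))"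
      by (auto simp: fun_eq_iff indicator_def)
    ultimately show "has_bochner_integral lebesgue
       (\<lambda>y. (indicator (cbox s t) y * c) * cnj (indicator (cbox s' t') y * c'))
       (c * cnj c' * of_real (measure lebesgue (cbox s t \<inter> cbox s' t')))"
      by (simp add: scaleR_conv_of_real mult_ac)
    have "has_bochner_integral M
       (\<lambda>w. (c * cnj c') * of_real (rect_increment B s t w * rect_increment B' s' t' w))
       ((c * cnj c') * of_real (q * measure lebesgue (cbox s t \<inter> cbox s' t')))"
      by (intro has_bochner_integral_mult_right has_bochner_integral_of_real
          rect_increment_covariance[OF cov that])
    then show "has_bochner_integral M
       (\<lambda>w. (c * of_real (rect_increment B s t w)) * cnj (c' * of_real (rect_increment B' s' t' w)))
       (of_real q * (c * cnj c' * of_real (measure lebesgue (cbox s t \<inter> cbox s' t'))))"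
      by (simp add: mult_ac)
  qed
  \<comment> \<open>Asserting a common value \<open>v\<close> for both integrals lets integrability
    and the identity pass through each \<open>Cons\<close> together; \<open>v\<close> is identified
    with the Lebesgue integral only at the end.\<close>
  have one: "\<exists>v. has_bochner_integral lebesgue (\<lambda>y. (indicator (cbox s t) y * c) * cnj (step_fun T y)) v \<and>
      has_bochner_integral M (\<lambda>w. (c * of_real (rect_increment B s t w)) * cnj (step_integral B' T w)) (of_real q * v)"
    if "s \<le> t" for c s t
    using T
  proof (induction T)
    case Nil
    then show ?case by (intro exI[of _ 0]) (simp add: step_fun_def step_integral_def has_bochner_integral_zero)
  next
    case (Cons x T)
    obtain c' s' t' where x: "x = (c', s', t')" by (cases x)
    have "s' \<le> t'" "proper_steps T" using Cons.prems by (auto simp: x proper_steps_def)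
    with Cons.IH obtain v where v:
      "has_bochner_integral lebesgue (\<lambda>y. (indicator (cbox s t) y * c) * cnj (step_fun T y)) v"
      "has_bochner_integral M (\<lambda>w. (c * of_real (rect_increment B s t w)) * cnj (step_integral B' T w)) (of_real q * v)"
      by blast
    note r = rect[OF that \<open>s' \<le> t'\<close>, of c c']
    have f: "cnj (step_fun (x # T) y) = cnj (indicator (cbox s' t') y * c') + cnj (step_fun T y)" for y
      by (simp add: step_fun_def x)
    have g: "cnj (step_integral B' (x # T) w) =
        cnj (c' * of_real (rect_increment B' s' t' w)) + cnj (step_integral B' T w)" for w
      by (simp add: step_integral_def x)
    show ?case
      using has_bochner_integral_add[OF r(1) v(1)] has_bochner_integral_add[OF r(2) v(2)]
      unfolding f g distrib_left[symmetric] by blast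
  qed
  have "\<exists>v. has_bochner_integral lebesgue (\<lambda>y. step_fun S y * cnj (step_fun T y)) v \<and>
      has_bochner_integral M (\<lambda>w. step_integral B S w * cnj (step_integral B' T w)) (of_real q * v)"
    using S
  proof (induction S)
    case Nil
    then show ?case by (intro exI[of _ 0]) (simp add: step_fun_def step_integral_def has_bochner_integral_zero)
  next
    case (Cons x S)
    obtain c s t where x: "x = (c, s, t)" by (cases x)
    have st: "s \<le> t" "proper_steps S" using Cons.prems by (auto simp: x proper_steps_def)
    with Cons.IH obtain v where v:
      "has_bochner_integral lebesgue (\<lambda>y. step_fun S y * cnj (step_fun T y)) v"
      "has_bochner_integral M (\<lambda>w. step_integral B S w * cnj (step_integral B' T w)) (of_real q * v)"
      by blast
    obtain u where u:
      "has_bochner_integral lebesgue (\<lambda>y. (indicator (cbox s t) y * c) * cnj (step_fun T y)) u"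
      "has_bochner_integral M (\<lambda>w. (c * of_real (rect_increment B s t w)) * cnj (step_integral B' T w)) (of_real q * u)"
      using one[OF st(1)] by blast
    have f: "step_fun (x # S) y = indicator (cbox s t) y * c + step_fun S y" for y
      by (simp add: step_fun_def x)
    have g: "step_integral B (x # S) w = c * of_real (rect_increment B s t w) + step_integral B S w" for w
      by (simp add: step_integral_def x)
    show ?case
      using has_bochner_integral_add[OF u(1) v(1)] has_bochner_integral_add[OF u(2) v(2)]
      unfolding f g distrib_left[symmetric] distrib_right[symmetric] by blast
  qed
  then show ?thesis by (metis has_bochner_integral_integral_eq)
qed

lemma square_int_step_fun: "square_int lebesgue (step_fun S)"
proof (induction S)
  case Nil
  then show ?case by (simp add: square_int_def step_fun_def[abs_def])
next
  case (Cons x S)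
  obtain c s t where x: "x = (c, s, t)" by (cases x)
  have "(\<integral>\<^sup>+y. ennreal ((cmod (indicator (cbox s t) y))\<^sup>2) \<partial>lebesgue) = (\<integral>\<^sup>+y. indicator (cbox s t) y \<partial>lebesgue)"
    by (intro nn_integral_cong) (auto simp: indicator_def)
  also have "\<dots> < \<infinity>" by (simp add: emeasure_lborel_cbox_eq)
  finally have "square_int lebesgue (indicator (cbox s t))"
    unfolding square_int_iff_nn_integral by (intro conjI borel_measurable_indicator) auto
  from square_int_add[OF square_int_cmult[OF this, of c] Cons]
  show ?case by (simp add: step_fun_def[abs_def] x mult.commute)
qed

lemma square_int_step_integral:
  assumes "prob_space M" "brownian_sheet M B"
  shows "square_int M (step_integral B S)"
proof (induction S)
  case Nil
  then show ?case by (simp add: square_int_def step_integral_def[abs_def])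
next
  case (Cons x S)
  obtain c s t where x: "x = (c, s, t)" by (cases x)
  note mom = brownian_sheet_moments[OF assms]
  have B: "square_int M (\<lambda>w. of_real (B y w))" for y
    using mom(1,3)[of y] by (simp add: square_int_def)
  have "square_int M (\<lambda>w. of_real (B t w) - of_real (B (vector [s$1, t$2]) w)
      - of_real (B (vector [t$1, s$2]) w) + of_real (B s w))"
    by (intro square_int_add square_int_diff B)
  then have "square_int M (\<lambda>w. of_real (rect_increment B s t w))"
    by (simp add: rect_increment_def)
  from square_int_add[OF square_int_cmult[OF this, of c] Cons]
  show ?case by (simp add: step_integral_def[abs_def] x)
qed

lemma step_integral_mean:
  assumes "prob_space M" "brownian_sheet M B"
  shows "has_bochner_integral M (step_integral B S) 0"
proof (induction S)
  case Nil
  then show ?case by (simp add: step_integral_def[abs_def] has_bochner_integral_zero)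
next
  case (Cons x S)
  obtain c s t where x: "x = (c, s, t)" by (cases x)
  have B: "has_bochner_integral M (B y) 0" for y
    using brownian_sheet_moments(2,4)[OF assms, of y] by (simp add: has_bochner_integral_iff)
  have "has_bochner_integral M (rect_increment B s t) (0 - 0 - 0 + 0)"
    unfolding rect_increment_def[abs_def]
    by (intro has_bochner_integral_add has_bochner_integral_diff B)
  then have "has_bochner_integral M (\<lambda>w. c * of_real (rect_increment B s t w)) (c * of_real (0 - 0 - 0 + 0))"
    by (intro has_bochner_integral_mult_right has_bochner_integral_of_real)
  from has_bochner_integral_add[OF this Cons]
  show ?case by (simp add: step_integral_def[abs_def] x)
qed

lemma step_integral_append: "step_integral B (S @ T) w = step_integral B S w + step_integral B T w"
  by (simp add: step_integral_def)

lemma step_integral_scale: "step_integral B (map (\<lambda>(c, r). (b * c, r)) S) w = b * step_integral B S w"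
  by (induction S) (auto simp: step_integral_def algebra_simps)

text \<open>The form in which Cauchy sequences of step functions are carried over to the sample
  space.\<close>

lemma step_isometry_norm:
  assumes W: "brownian_sheet_pair M W" and S: "proper_steps S"
  shows "(\<integral>\<^sup>+w. ennreal ((cmod (step_integral (W i) S w))\<^sup>2) \<partial>M) =
     (\<integral>\<^sup>+y. ennreal ((cmod (step_fun S y))\<^sup>2) \<partial>lebesgue)"
proof -
  have M: "prob_space M" "brownian_sheet M (W i)" using W by (auto simp: brownian_sheet_pair_def)
  have "has_bochner_integral M (\<lambda>w. step_integral (W i) S w * cnj (step_integral (W i) S w))
     (of_real 1 * (LINT y|lebesgue. step_fun S y * cnj (step_fun S y)))"
    using brownian_sheet_pair_covariance[OF W, of i _ i] by (intro step_isometry S) simp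
  then have "(LINT w|M. complex_of_real ((cmod (step_integral (W i) S w))\<^sup>2)) =
      (LINT y|lebesgue. complex_of_real ((cmod (step_fun S y))\<^sup>2))"
    by (simp only: has_bochner_integral_iff complex_norm_square[symmetric] of_real_1 mult_1)
  then have "(LINT w|M. (cmod (step_integral (W i) S w))\<^sup>2) = (LINT y|lebesgue. (cmod (step_fun S y))\<^sup>2)"
    unfolding integral_complex_of_real by (simp only: of_real_eq_iff)
  then show ?thesis
    by (simp add: nn_integral_cmod_square square_int_step_integral[OF M] square_int_step_fun)
qed

section \<open>Extension to square-integrable integrands\<close>

lemma is_wiener_integral_square_int:
  assumes W: "brownian_sheet_pair M W" and X: "is_wiener_integral M (W i) f X"
  shows "square_int lebesgue f" "square_int M X"
proof -
  have M: "prob_space M" "brownian_sheet M (W i)" using W by (auto simp: brownian_sheet_pair_def)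
  obtain S where "(\<lambda>n. \<integral>\<^sup>+ y. ennreal ((cmod (f y - step_fun (S n) y))\<^sup>2) \<partial>lebesgue) \<longlonglongrightarrow> 0"
        "(\<lambda>n. \<integral>\<^sup>+ w. ennreal ((cmod (X w - step_integral (W i) (S n) w))\<^sup>2) \<partial>M) \<longlonglongrightarrow> 0"
    using X by (auto simp: is_wiener_integral_def)
  then show "square_int lebesgue f" "square_int M X"
    using X square_int_limit[OF square_int_step_fun, of f S]
      square_int_limit[OF square_int_step_integral[OF M], of X S]
    by (auto simp: is_wiener_integral_def)
qed

text \<open>Continuity of the inner product is applied on the sample space and on the plane; the
  step lists approximating \<open>f\<close> and \<open>h\<close> are chosen independently of each
  other.\<close>

lemma wiener_isometry:
  assumes W: "brownian_sheet_pair M W"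
    and X: "is_wiener_integral M (W i) f X" and Y: "is_wiener_integral M (W j) h Y"
  shows "has_bochner_integral M (\<lambda>w. X w * cnj (Y w))
     (of_bool (i = j) * (LINT y|lebesgue. f y * cnj (h y)))"
proof -
  have M: "prob_space M" "brownian_sheet M (W i)" for i using W by (auto simp: brownian_sheet_pair_def)
  note sX = is_wiener_integral_square_int[OF W X] and sY = is_wiener_integral_square_int[OF W Y]
  obtain S where S: "\<And>n. proper_steps (S n)"
    "(\<lambda>n. \<integral>\<^sup>+ y. ennreal ((cmod (f y - step_fun (S n) y))\<^sup>2) \<partial>lebesgue) \<longlonglongrightarrow> 0"
    "(\<lambda>n. \<integral>\<^sup>+ w. ennreal ((cmod (X w - step_integral (W i) (S n) w))\<^sup>2) \<partial>M) \<longlonglongrightarrow> 0"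
    using X by (auto simp: is_wiener_integral_def)
  obtain T where T: "\<And>n. proper_steps (T n)"
    "(\<lambda>n. \<integral>\<^sup>+ y. ennreal ((cmod (h y - step_fun (T n) y))\<^sup>2) \<partial>lebesgue) \<longlonglongrightarrow> 0"
    "(\<lambda>n. \<integral>\<^sup>+ w. ennreal ((cmod (Y w - step_integral (W j) (T n) w))\<^sup>2) \<partial>M) \<longlonglongrightarrow> 0"
    using Y by (auto simp: is_wiener_integral_def)
  have "(LINT w|M. step_integral (W i) (S n) w * cnj (step_integral (W j) (T n) w)) =
      of_real (of_bool (i = j)) * (LINT y|lebesgue. step_fun (S n) y * cnj (step_fun (T n) y))" for n
    by (intro has_bochner_integral_integral_eq step_isometry brownian_sheet_pair_covariance W S T)
  moreover have "(\<lambda>n. LINT w|M. step_integral (W i) (S n) w * cnj (step_integral (W j) (T n) w))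
      \<longlonglongrightarrow> (LINT w|M. X w * cnj (Y w))"
    by (intro tendsto_inner_product square_int_step_integral[OF M] sX sY S T)
  moreover have "(\<lambda>n. of_real (of_bool (i = j)) * (LINT y|lebesgue. step_fun (S n) y * cnj (step_fun (T n) y)))
      \<longlonglongrightarrow> of_real (of_bool (i = j)) * (LINT y|lebesgue. f y * cnj (h y))"
    by (intro tendsto_mult tendsto_const tendsto_inner_product square_int_step_fun sX sY S T)
  ultimately have "(LINT w|M. X w * cnj (Y w)) =
      of_real (of_bool (i = j)) * (LINT y|lebesgue. f y * cnj (h y))"
    by (simp add: LIMSEQ_unique)
  then show ?thesis
    using square_int_integrable_mult[OF sX(2) sY(2)] by (simp add: has_bochner_integral_iff)
qed

text \<open>The mean is the inner product with the constant 1, which is square integrable on a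
  probability space, and step integrals have mean zero.\<close>

lemma wiener_integral_mean:
  assumes W: "brownian_sheet_pair M W" and X: "is_wiener_integral M (W i) f X"
  shows "has_bochner_integral M X 0"
proof -
  have M: "prob_space M" "brownian_sheet M (W i)" for i using W by (auto simp: brownian_sheet_pair_def)
  interpret prob_space M by (rule M)
  have one: "square_int M (\<lambda>_. 1)"
    by (rule square_int_const) (rule finite_measure_axioms)
  note sX = is_wiener_integral_square_int(2)[OF W X]
  obtain S where S: 
    "(\<lambda>n. \<integral>\<^sup>+ w. ennreal ((cmod (X w - step_integral (W i) (S n) w))\<^sup>2) \<partial>M) \<longlonglongrightarrow> 0"
    using X by (auto simp: is_wiener_integral_def)
  have "(\<lambda>n. LINT w|M. step_integral (W i) (S n) w * cnj 1) \<longlonglongrightarrow> (LINT w|M. X w * cnj 1)"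
    by (rule tendsto_inner_product[OF square_int_step_integral[OF M] one sX one S]) simp
  then have "(LINT w|M. X w) = 0"
    using step_integral_mean[OF M, of i] by (simp add: has_bochner_integral_iff LIMSEQ_const_iff)
  moreover have "integrable M X"
    using square_int_integrable_mult[OF sX one] by simp
  ultimately show ?thesis by (simp add: has_bochner_integral_iff)
qed

text \<open>Step functions converging to \<open>f\<close> form a Cauchy sequence; by the isometry so
  do their step integrals, and completeness supplies the limit.\<close>

lemma wiener_integral_exists:
  assumes W: "brownian_sheet_pair M W"
    and f: "square_int lebesgue f" and supp: "\<And>y. y \<notin> cbox p q \<Longrightarrow> f y = 0"
  shows "\<exists>X. is_wiener_integral M (W i) f X"
proof -
  have M: "prob_space M" "brownian_sheet M (W i)" for i using W by (auto simp: brownian_sheet_pair_def)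
  interpret prob_space M by (rule M)
  note [measurable] = square_intD(1)[OF f]
  have "step_approximable f" by (rule step_approximable_square_int[OF f supp])
  \<comment> \<open>The tolerance \<open>(1/4)^n/4\<close> is chosen so that the doubled triangle
    inequality yields exactly the rate \<open>(1/4)^n\<close> required for completeness.\<close>
  then have "\<exists>S. proper_steps S \<and>
      (\<integral>\<^sup>+y. ennreal ((cmod (f y - step_fun S y))\<^sup>2) \<partial>lebesgue) < ennreal ((1/4)^n/4)" for n :: nat
    by (simp add: step_approximable_def)
  then obtain S where S: "\<And>n. proper_steps (S n)"
    and close: "\<And>n. (\<integral>\<^sup>+y. ennreal ((cmod (f y - step_fun (S n) y))\<^sup>2) \<partial>lebesgue) < ennreal ((1/4)^n/4)"
    by metis
  define Y where "Y n = step_integral (W i) (S n)" for n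
  have Y: "square_int M (Y n)" for n
    unfolding Y_def by (rule square_int_step_integral[OF M])
  have cauchy: "(\<integral>\<^sup>+w. ennreal ((cmod (Y m w - Y n w))\<^sup>2) \<partial>M) \<le> ennreal ((1/4)^n)" if "n \<le> m" for m n
  proof -
    \<comment> \<open>The difference of two step functions is written as a single step list, so that
      the isometry applies to it.\<close>
    define R where "R = S m @ map (\<lambda>(c, r). (-1 * c, r)) (S n)"
    have R: "proper_steps R" using S[of m] S[of n] by (auto simp: R_def proper_steps_def)
    have "(\<integral>\<^sup>+w. ennreal ((cmod (Y m w - Y n w))\<^sup>2) \<partial>M) =
        (\<integral>\<^sup>+w. ennreal ((cmod (step_integral (W i) R w))\<^sup>2) \<partial>M)"
      unfolding R_def Y_def step_integral_append step_integral_scale by simp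
    also have "\<dots> = (\<integral>\<^sup>+y. ennreal ((cmod (step_fun R y))\<^sup>2) \<partial>lebesgue)"
      by (rule step_isometry_norm[OF W R])
    also have "\<dots> = (\<integral>\<^sup>+y. ennreal ((cmod ((f y - step_fun (S n) y) + (step_fun (S m) y - f y)))\<^sup>2) \<partial>lebesgue)"
      unfolding R_def step_fun_append step_fun_scale by simp
    also have "\<dots> \<le> 2 * (\<integral>\<^sup>+y. ennreal ((cmod (f y - step_fun (S n) y))\<^sup>2) \<partial>lebesgue) +
        2 * (\<integral>\<^sup>+y. ennreal ((cmod (step_fun (S m) y - f y))\<^sup>2) \<partial>lebesgue)"
      by (rule nn_integral_cmod_add_square_le) auto
    also have "\<dots> < ennreal ((1/4)^n)"
    proof (rule ennreal_double_add_less[OF close])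
      have "(\<integral>\<^sup>+y. ennreal ((cmod (step_fun (S m) y - f y))\<^sup>2) \<partial>lebesgue) < ennreal ((1/4)^m/4)"
        using close[of m] by (simp add: norm_minus_commute)
      also have "\<dots> \<le> ennreal ((1/4)^n/4)"
        using power_decreasing[OF that, of "1/4::real"] by (intro ennreal_leI) simp
      finally show "(\<integral>\<^sup>+y. ennreal ((cmod (step_fun (S m) y - f y))\<^sup>2) \<partial>lebesgue) < ennreal ((1/4)^n/4)" .
    qed
    finally show ?thesis by (rule less_imp_le)
  qed
  obtain X where X: "X \<in> borel_measurable M"
    "(\<lambda>n. \<integral>\<^sup>+w. ennreal ((cmod (X w - Y n w))\<^sup>2) \<partial>M) \<longlonglongrightarrow> 0"
    using square_int_complete[OF Y cauchy] by blast
  have "(\<lambda>n. (1/4::real)^n/4) \<longlonglongrightarrow> 0/4"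
    by (intro tendsto_divide LIMSEQ_realpow_zero tendsto_const) auto
  then have z: "(\<lambda>n. ennreal ((1/4)^n/4)) \<longlonglongrightarrow> 0"
    by (simp add: tendsto_ennreal_iff flip: ennreal_0)
  have "(\<lambda>n. \<integral>\<^sup>+ y. ennreal ((cmod (f y - step_fun (S n) y))\<^sup>2) \<partial>lebesgue) \<longlonglongrightarrow> 0"
    by (rule tendsto_sandwich[OF _ _ tendsto_const z]) (auto intro!: always_eventually less_imp_le[OF close])
  then have "is_wiener_integral M (W i) f X"
    using X S unfolding is_wiener_integral_def Y_def by auto
  then show ?thesis by blast
qed

section \<open>Covariances of far-field patterns\<close>

text \<open>A vector is the sum of the images of its coordinates under the bounded linear maps
  \<open>axis i\<close>. Applied twice, this reduces matrix-valued integrals to their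
  entries.\<close>

lemma has_bochner_integral_vec:
  fixes f :: "'a \<Rightarrow> 'b::euclidean_space ^ 'n"
  assumes "\<And>i. has_bochner_integral M (\<lambda>w. f w $ i) (c $ i)"
  shows "has_bochner_integral M f c"
proof -
  have bl: "bounded_linear (axis i :: 'b \<Rightarrow> 'b ^ 'n)" for i
    by (intro linear_conv_bounded_linear[THEN iffD1] linearI) (auto simp: vec_eq_iff axis_def)
  have "v = (\<Sum>i\<in>UNIV. axis i (v $ i))" for v :: "'b ^ 'n"
    by (simp add: vec_eq_iff axis_def)
  moreover have "has_bochner_integral M (\<lambda>w. \<Sum>i\<in>UNIV. axis i (f w $ i)) (\<Sum>i\<in>UNIV. axis i (c $ i))"
    by (intro has_bochner_integral_sum has_bochner_integral_bounded_linear[OF bl] assms)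
  ultimately show ?thesis by simp
qed

lemma domain_square_subset_cbox: "domain_square a \<subseteq> cbox (vec (- a / 2)) (vec (a / 2))"
  by (simp add: domain_square_def box_subset_cbox)

text \<open>Existence turns the choice by \<open>SOME\<close> into a genuine Wiener integral; the
  bounded square supplies the enclosing box.\<close>

lemma wiener_integral_spec:
  assumes W: "brownian_sheet_pair M W"
    and f: "square_int lebesgue (\<lambda>y. indicator (domain_square a) y * f y)"
  shows "is_wiener_integral M (W i) (\<lambda>y. indicator (domain_square a) y * f y)
    (wiener_integral M (W i) (domain_square a) f)"
proof -
  have "\<exists>X. is_wiener_integral M (W i) (\<lambda>y. indicator (domain_square a) y * f y) X"
    using domain_square_subset_cbox[of a]
    by (intro wiener_integral_exists[OF W f, of "vec (- a / 2)" "vec (a / 2)"]) (auto simp: indicator_def)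
  from someI_ex[OF this] show ?thesis unfolding wiener_integral_def .
qed

text \<open>Centring removes the deterministic part of the source. The double sum over noise
  components that remains collapses to \<open>j = k\<close>, since integrals against different
  components are uncorrelated.\<close>

lemma covariance_source_integral:
  fixes K L :: "real^2 \<Rightarrow> complex^2^2"
  assumes W: "brownian_sheet_pair M W"
    and K: "\<And>i j. square_int lebesgue (\<lambda>y. indicator (domain_square a) y * (K y ** diag_mat (\<sigma> y)) $ i $ j)"
    and L: "\<And>i j. square_int lebesgue (\<lambda>y. indicator (domain_square a) y * (L y ** diag_mat (\<sigma> y)) $ i $ j)"
  shows "covariance_mat M (\<lambda>w. c *s source_integral M W (domain_square a) g \<sigma> K w)
      (\<lambda>w. d *s source_integral M W (domain_square a) g \<sigma> L w) =
    (\<chi> r s. c * cnj d * (\<Sum>j\<in>UNIV. LINT y|lebesgue.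
      (indicator (domain_square a) y * (K y ** diag_mat (\<sigma> y)) $ r $ j) *
      cnj (indicator (domain_square a) y * (L y ** diag_mat (\<sigma> y)) $ s $ j)))"
proof -
  interpret prob_space M using W by (simp add: brownian_sheet_pair_def)
  define X where "X i j = wiener_integral M (W j) (domain_square a) (\<lambda>y. (K y ** diag_mat (\<sigma> y)) $ i $ j)" for i j
  define Y where "Y i j = wiener_integral M (W j) (domain_square a) (\<lambda>y. (L y ** diag_mat (\<sigma> y)) $ i $ j)" for i j
  have X: "is_wiener_integral M (W j) (\<lambda>y. indicator (domain_square a) y * (K y ** diag_mat (\<sigma> y)) $ i $ j) (X i j)" for i j
    unfolding X_def by (rule wiener_integral_spec[OF W K])
  have Y: "is_wiener_integral M (W j) (\<lambda>y. indicator (domain_square a) y * (L y ** diag_mat (\<sigma> y)) $ i $ j) (Y i j)" for i j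
    unfolding Y_def by (rule wiener_integral_spec[OF W L])
  have centre: "c *s source_integral M W (domain_square a) g \<sigma> K w -
      (LINT w|M. c *s source_integral M W (domain_square a) g \<sigma> K w) = (\<chi> i. c * (\<Sum>j\<in>UNIV. Z i j w))"
    if Z: "\<And>i j. Z i j = wiener_integral M (W j) (domain_square a) (\<lambda>y. (K y ** diag_mat (\<sigma> y)) $ i $ j)"
      and mean: "\<And>i j. has_bochner_integral M (Z i j) 0" for c K Z w
  proof -
    \<comment> \<open>The contribution of \<open>g\<close> is constant in \<open>w\<close>; as the
      Wiener integrals have mean zero, it is the mean up to the factor \<open>c\<close> and
      cancels.\<close>
    define b where "b = (LINT y:domain_square a|lebesgue. K y *v complex_vec (g y))"
    have src: "source_integral M W (domain_square a) g \<sigma> K w = b + (\<chi> i. \<Sum>j\<in>UNIV. Z i j w)" for w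
      by (simp add: source_integral_def b_def Z)
    have "has_bochner_integral M (\<lambda>w. c *s source_integral M W (domain_square a) g \<sigma> K w) (c *s b)"
    proof (rule has_bochner_integral_vec)
      fix i
      have "has_bochner_integral M (\<lambda>w. b $ i) (measure M (space M) *\<^sub>R (b $ i))"
        by (auto simp: has_bochner_integral_iff)
      moreover have "has_bochner_integral M (\<lambda>w. \<Sum>j\<in>UNIV. Z i j w) (\<Sum>j\<in>(UNIV :: 2 set). 0)"
        by (intro has_bochner_integral_sum mean)
      ultimately have "has_bochner_integral M (\<lambda>w. c * (b $ i + (\<Sum>j\<in>UNIV. Z i j w)))
          (c * (measure M (space M) *\<^sub>R (b $ i) + (\<Sum>j\<in>(UNIV :: 2 set). 0)))"
        by (intro has_bochner_integral_mult_right has_bochner_integral_add)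
      then show "has_bochner_integral M (\<lambda>w. (c *s source_integral M W (domain_square a) g \<sigma> K w) $ i) ((c *s b) $ i)"
        by (simp add: src prob_space distrib_left)
    qed
    then have "(LINT w|M. c *s source_integral M W (domain_square a) g \<sigma> K w) = c *s b"
      by (rule has_bochner_integral_integral_eq)
    then show ?thesis
      by (simp add: src vec_eq_iff algebra_simps)
  qed
  note cX = centre[of X K, OF X_def wiener_integral_mean[OF W X]]
  note cY = centre[of Y L, OF Y_def wiener_integral_mean[OF W Y]]
  define J where "J r s j k = (LINT y|lebesgue.
      (indicator (domain_square a) y * (K y ** diag_mat (\<sigma> y)) $ r $ j) *
      cnj (indicator (domain_square a) y * (L y ** diag_mat (\<sigma> y)) $ s $ k))" for r s j k
  have "has_bochner_integral M
      (\<lambda>w. outer_prod (\<chi> i. c * (\<Sum>j\<in>UNIV. X i j w)) (\<chi> i. d * (\<Sum>j\<in>UNIV. Y i j w)))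
      (\<chi> r s. c * cnj d * (\<Sum>j\<in>UNIV. J r s j j))"
  proof (intro has_bochner_integral_vec)
    fix r s
    have "has_bochner_integral M (\<lambda>w. c * cnj d * (\<Sum>j\<in>UNIV. \<Sum>k\<in>UNIV. X r j w * cnj (Y s k w)))
        (c * cnj d * (\<Sum>j\<in>UNIV. \<Sum>k\<in>UNIV. of_bool (j = k) * J r s j k))"
      unfolding J_def
      by (intro has_bochner_integral_mult_right has_bochner_integral_sum wiener_isometry[OF W X Y])
    moreover have "(\<Sum>j\<in>UNIV. \<Sum>k\<in>UNIV. of_bool (j = k) * J r s j k) = (\<Sum>j\<in>UNIV. J r s j j)"
      by (simp add: UNIV_2)
    moreover have "c * cnj d * (\<Sum>j\<in>UNIV. \<Sum>k\<in>UNIV. X r j w * cnj (Y s k w)) =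
       outer_prod (\<chi> i. c * (\<Sum>j\<in>UNIV. X i j w)) (\<chi> i. d * (\<Sum>j\<in>UNIV. Y i j w)) $ r $ s" for w
      by (simp add: outer_prod_def UNIV_2 algebra_simps)
    ultimately show "has_bochner_integral M
      (\<lambda>w. outer_prod (\<chi> i. c * (\<Sum>j\<in>UNIV. X i j w)) (\<chi> i. d * (\<Sum>j\<in>UNIV. Y i j w)) $ r $ s)
      ((\<chi> r s. c * cnj d * (\<Sum>j\<in>UNIV. J r s j j)) $ r $ s)"
      by simp
  qed
  then show ?thesis
    unfolding covariance_mat_def cX cY by (simp add: has_bochner_integral_iff J_def)
qed

lemma scale_mat_diag_mat_entry:
  "(scale_mat c P ** diag_mat v) $ i $ j = c * P $ i $ j * of_real (v $ j)"
  by (simp add: matrix_matrix_mult_def scale_mat_def diag_mat_def if_distrib[of "\<lambda>x. _ * x"] cong: if_cong)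

section \<open>Reduction of the covariance data to Fourier integrals\<close>

lemma domain_square_lmeasurable: "domain_square a \<in> lmeasurable"
  by (simp add: domain_square_def)

text \<open>On the square, which has finite measure, a square-integrable
  \<open>\<sigma>\<^sup>2\<close> is integrable, and this says that \<open>\<sigma>\<close> itself
  is square integrable. A bounded factor, here a plane wave times a polarization entry, preserves
  this.\<close>

lemma admissible_source_square_int:
  assumes adm: "admissible_source a g \<sigma>"
    and h: "h \<in> borel_measurable lebesgue" "\<And>y. cmod (h y) \<le> C"
  shows "square_int lebesgue (\<lambda>y. indicator (domain_square a) y * (h y * of_real (\<sigma> y $ j)))"
proof -
  let ?D = "domain_square a"
  have D: "?D \<in> sets lebesgue" and [simp]: "finite_measure (lebesgue_on ?D)"
    using domain_square_lmeasurable[of a] by (auto simp: fmeasurable_def intro: finite_measure_lebesgue_on)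
  have pos: "0 \<le> \<sigma> y $ j" for y using adm by (simp add: admissible_source_def)
  have "square_integrable_on ?D (\<lambda>x. (\<sigma> x $ j)\<^sup>2)"
    using adm by (simp add: admissible_source_def)
  then have m: "(\<lambda>x. (\<sigma> x $ j)\<^sup>2) \<in> borel_measurable (lebesgue_on ?D)"
    and "integrable (lebesgue_on ?D) (\<lambda>x. (\<sigma> x $ j)\<^sup>2)"
    by (auto simp: square_integrable_on_def intro: finite_measure.square_integrable_imp_integrable)
  then have int: "integrable lebesgue (\<lambda>x. indicator ?D x *\<^sub>R (\<sigma> x $ j)\<^sup>2)"
    using D by (simp add: integrable_restrict_space)
  \<comment> \<open>Measurability is given for the square only; nonnegativity makes
    \<open>\<sigma>\<close> the root of its square.\<close>
  have "(\<lambda>x. sqrt ((\<sigma> x $ j)\<^sup>2)) \<in> borel_measurable (lebesgue_on ?D)"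
    using m by measurable
  then have m': "(\<lambda>x. indicator ?D x *\<^sub>R (\<sigma> x $ j)) \<in> borel_measurable lebesgue"
    using D pos by (simp add: borel_measurable_restrict_space_iff)
  define z where "z y = complex_of_real (indicator ?D y *\<^sub>R (\<sigma> y $ j))" for y
  have [measurable]: "z \<in> borel_measurable lebesgue"
    unfolding z_def by (intro measurable_compose[OF m' borel_measurable_of_real])
  note [measurable] = h(1)
  have "(cmod (z y))\<^sup>2 = indicator ?D y *\<^sub>R (\<sigma> y $ j)\<^sup>2" for y
    by (simp add: z_def indicator_def)
  with int have z: "integrable lebesgue (\<lambda>y. C\<^sup>2 * (cmod (z y))\<^sup>2)"
    by simp
  have "integrable lebesgue (\<lambda>y. (cmod (h y * z y))\<^sup>2)"
  proof (rule Bochner_Integration.integrable_bound[OF z])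
    show "AE y in lebesgue. norm ((cmod (h y * z y))\<^sup>2) \<le> norm (C\<^sup>2 * (cmod (z y))\<^sup>2)"
    proof (rule AE_I2)
      fix y
      have "cmod (h y * z y) \<le> C * cmod (z y)"
        unfolding norm_mult by (intro mult_right_mono h(2)) simp
      then have "(cmod (h y * z y))\<^sup>2 \<le> (C * cmod (z y))\<^sup>2"
        by (rule power_mono) simp
      then show "norm ((cmod (h y * z y))\<^sup>2) \<le> norm (C\<^sup>2 * (cmod (z y))\<^sup>2)"
        by (simp add: power_mult_distrib)
    qed
  qed simp
  moreover have eq: "indicator ?D y * (h y * of_real (\<sigma> y $ j)) = h y * z y" for y
    by (simp add: z_def indicator_def)
  ultimately show ?thesis unfolding eq square_int_def by simp
qed

text \<open>Entry by entry, this is the product of the first polarization, the diagonal matrix of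
  the \<open>V j\<close>, and the conjugate transpose of the second polarization. The constants
  \<open>c\<close> collect the scalar prefactors of the far-field patterns.\<close>

lemma covariance_data_eq:
  fixes l :: "int^2" and d :: "real^2"
  assumes W: "brownian_sheet_pair M W" and adm: "admissible_source a g \<sigma>"
    and mu: "mu > 0" "lam + mu > 0" and a: "a > 0" and \<omega>: "\<omega>\<^sub>0 > 0"
  defines "c \<equiv> \<lambda>m k. gamma_coeff k * of_real (1 / (wave_speed lam mu m)\<^sup>2)"
    and "V \<equiv> \<lambda>j. LINT y|lebesgue. indicator (domain_square a) y * (cnj (fourier_basis a l y) * of_real ((\<sigma> y $ j)\<^sup>2))"
    and "e \<equiv> obs_direction d l"
  shows "covariance_data a lam mu M W g \<sigma> \<omega>\<^sub>0 d l m n = (\<chi> r s.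
     c m (\<omega>\<^sub>0 + tau a l) * cnj (c n \<omega>\<^sub>0) *
     (\<Sum>j\<in>UNIV. polarization m e $ r $ j * cnj (polarization n e $ s $ j) * V j))"
proof -
  define k where "k = \<omega>\<^sub>0 + tau a l"
  have tau: "tau a l \<ge> 0" using a by (simp add: tau_def)
  then have k: "k > 0" using \<omega> by (simp add: k_def)
  have speed: "wave_speed lam mu m > 0" for m using mu by (cases m) auto
  define K where "K m k y = scale_mat (exp (- \<i> * of_real (k * (e \<bullet> y)))) (polarization m e)" for m k y
  \<comment> \<open>At angular frequency \<open>wave_speed lam mu m * k\<close> the wave number is
    \<open>k\<close> for either mode, and the squared ratio of wave number to frequency becomes the
    inverse squared speed.\<close>
  have ff: "far_field a lam mu M W g \<sigma> m e (wave_speed lam mu m * k) =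
      (\<lambda>w. c m k *s source_integral M W (domain_square a) g \<sigma> (K m k) w)" if "k > 0" for m k
    using that speed[of m] unfolding K_def[abs_def]
    by (simp add: fun_eq_iff far_field_def Let_def c_def power_mult_distrib)
  have sq: "square_int lebesgue (\<lambda>y. indicator (domain_square a) y * (K m k y ** diag_mat (\<sigma> y)) $ i $ j)" for m k i j
    unfolding K_def scale_mat_diag_mat_entry
  proof (rule admissible_source_square_int[OF adm])
    have "continuous_on UNIV (\<lambda>y. exp (- \<i> * of_real (k * (e \<bullet> y))) * polarization m e $ i $ j)"
      by (intro continuous_intros)
    then have "(\<lambda>y. exp (- \<i> * of_real (k * (e \<bullet> y))) * polarization m e $ i $ j) \<in> borel_measurable borel"
      by (rule borel_measurable_continuous_onI)
    then show "(\<lambda>y. exp (- \<i> * of_real (k * (e \<bullet> y))) * polarization m e $ i $ j) \<in> borel_measurable lebesgue"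
      by (intro measurable_completion) simp
    show "cmod (exp (- \<i> * of_real (k * (e \<bullet> y))) * polarization m e $ i $ j) \<le> cmod (polarization m e $ i $ j)" for y
      by (simp add: norm_mult)
  qed
  \<comment> \<open>For \<open>l = 0\<close> the direction is the prescribed \<open>d\<close>, but
    then \<open>tau a l = 0\<close> and both sides vanish.\<close>
  have phase: "tau a l * (e \<bullet> y) = 2 * pi / a * (lattice_vec l \<bullet> y)" for y
  proof (cases "l = 0")
    case True
    then have "lattice_vec l = 0" by (simp add: lattice_vec_def vec_eq_iff)
    then show ?thesis by (simp add: tau_def)
  next
    case False
    then have "lattice_vec l \<noteq> 0" by (auto simp: lattice_vec_def vec_eq_iff)
    then show ?thesis using False by (simp add: tau_def e_def obs_direction_def)
  qed
  have wave: "exp (- \<i> * of_real (k * (e \<bullet> y))) * cnj (exp (- \<i> * of_real (\<omega>\<^sub>0 * (e \<bullet> y)))) =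
      cnj (fourier_basis a l y)" for y
    unfolding fourier_basis_def phase[symmetric] exp_cnj exp_add[symmetric]
    by (simp add: k_def algebra_simps)
  have entry: "(LINT y|lebesgue. (indicator (domain_square a) y * (K m k y ** diag_mat (\<sigma> y)) $ r $ j) *
        cnj (indicator (domain_square a) y * (K n \<omega>\<^sub>0 y ** diag_mat (\<sigma> y)) $ s $ j)) =
      polarization m e $ r $ j * cnj (polarization n e $ s $ j) * V j" for r s j
  proof -
    have eq: "(indicator (domain_square a) y * (K m k y ** diag_mat (\<sigma> y)) $ r $ j) *
        cnj (indicator (domain_square a) y * (K n \<omega>\<^sub>0 y ** diag_mat (\<sigma> y)) $ s $ j) =
      (polarization m e $ r $ j * cnj (polarization n e $ s $ j)) *
      (indicator (domain_square a) y * (cnj (fourier_basis a l y) * of_real ((\<sigma> y $ j)\<^sup>2)))" for y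
      unfolding K_def scale_mat_diag_mat_entry wave[symmetric]
      by (simp add: indicator_def power2_eq_square mult_ac del: exp_cnj)
    show ?thesis unfolding V_def eq by (rule integral_mult_right_zero)
  qed
  show ?thesis
    unfolding covariance_data_def e_def[symmetric] k_def[symmetric] ff[OF k] ff[OF \<omega>]
      covariance_source_integral[OF W sq sq] entry ..
qed

text \<open>Expresses the coefficient through the same scalar integrals that occur in the covariance
  data.\<close>

lemma variance_coeff_eq:
  assumes adm: "admissible_source a g \<sigma>"
  shows "variance_coeff a \<sigma> l = (1 / a\<^sup>2) *\<^sub>R (\<chi> i j. if i = j then
    LINT y|lebesgue. indicator (domain_square a) y * (cnj (fourier_basis a l y) * of_real ((\<sigma> y $ i)\<^sup>2)) else 0)"
proof -
  let ?D = "domain_square a"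
  let ?V = "\<lambda>i. LINT y|lebesgue. indicator ?D y * (cnj (fourier_basis a l y) * of_real ((\<sigma> y $ i)\<^sup>2))"
  have cont: "continuous_on UNIV (\<lambda>y. cnj (fourier_basis a l y))"
    unfolding fourier_basis_def by (intro continuous_intros)
  then have meas: "(\<lambda>y. cnj (fourier_basis a l y)) \<in> borel_measurable lebesgue"
    by (intro measurable_completion) (simp add: borel_measurable_continuous_onI)
  have int: "has_bochner_integral lebesgue
      (\<lambda>y. indicator ?D y * (cnj (fourier_basis a l y) * of_real ((\<sigma> y $ i)\<^sup>2))) (?V i)" for i
  proof -
    \<comment> \<open>Splitting \<open>\<sigma>\<^sup>2\<close> into two factors
      \<open>\<sigma>\<close> exhibits the integrand as a product of two square-integrable
      functions.\<close>
    have "integrable lebesgue (\<lambda>y. (indicator ?D y * (cnj (fourier_basis a l y) * of_real (\<sigma> y $ i))) *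
        cnj (indicator ?D y * (1 * of_real (\<sigma> y $ i))))"
      by (intro square_int_integrable_mult admissible_source_square_int[OF adm, where C = 1] meas)
        (auto simp: fourier_basis_def)
    moreover have "(indicator ?D y * (cnj (fourier_basis a l y) * of_real (\<sigma> y $ i))) *
        cnj (indicator ?D y * (1 * of_real (\<sigma> y $ i))) =
        indicator ?D y * (cnj (fourier_basis a l y) * of_real ((\<sigma> y $ i)\<^sup>2))" for y
      by (simp add: indicator_def power2_eq_square)
    ultimately show ?thesis by (simp only: has_bochner_integral_iff simp_thms)
  qed
  have entry: "(indicator ?D y *\<^sub>R scale_mat (cnj (fourier_basis a l y)) (diag_mat (\<sigma> y) ** diag_mat (\<sigma> y))) $ i $ j =
      (if i = j then indicator ?D y * (cnj (fourier_basis a l y) * of_real ((\<sigma> y $ i)\<^sup>2)) else 0)" for y i j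
  proof -
    have "(diag_mat (\<sigma> y) ** diag_mat (\<sigma> y)) $ i $ j = (if i = j then of_real ((\<sigma> y $ i)\<^sup>2) else 0)"
      using scale_mat_diag_mat_entry[of 1 "diag_mat (\<sigma> y)" "\<sigma> y" i j]
      by (simp add: scale_mat_def diag_mat_def power2_eq_square)
    then show ?thesis
      by (simp add: scale_mat_def indicator_def)
  qed
  have "has_bochner_integral lebesgue
      (\<lambda>y. indicator ?D y *\<^sub>R scale_mat (cnj (fourier_basis a l y)) (diag_mat (\<sigma> y) ** diag_mat (\<sigma> y)))
      (\<chi> i j. if i = j then ?V i else 0)"
  proof (intro has_bochner_integral_vec)
    fix i j
    show "has_bochner_integral lebesgue (\<lambda>y. (indicator ?D y *\<^sub>R scale_mat (cnj (fourier_basis a l y))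
        (diag_mat (\<sigma> y) ** diag_mat (\<sigma> y))) $ i $ j) ((\<chi> i j. if i = j then ?V i else 0) $ i $ j)"
      unfolding entry using int[of i]
      by (cases "i = j") (simp_all only: simp_thms if_True if_False vec_lambda_beta has_bochner_integral_zero)
  qed
  then show ?thesis
    unfolding variance_coeff_def set_lebesgue_integral_def by (simp add: has_bochner_integral_iff)
qed

section \<open>Recovery of the Fourier coefficient\<close>

lemma gamma_coeff_nonzero: "k > 0 \<Longrightarrow> gamma_coeff k \<noteq> 0"
  by (simp add: gamma_coeff_def)

text \<open>The shear polarization is by definition the complement of the compressional one, so the
  identity is purely algebraic in \<open>e\<close>. It is read off on the diagonal entry at
  \<open>r\<close>, where the identity matrix selects the single term \<open>V r\<close>.\<close>

lemma sum_polarizations: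
  fixes V :: "2 \<Rightarrow> complex" and e :: "real^2" and r :: 2
  defines "S m n \<equiv> \<Sum>j\<in>UNIV. polarization m e $ r $ j * cnj (polarization n e $ r $ j) * V j"
  shows "S Compressional Compressional + S Compressional Shear +
    S Shear Compressional + S Shear Shear = V r"
proof -
  have I: "polarization Compressional e $ r $ j + polarization Shear e $ r $ j = of_bool (r = j)" for j
    by (simp add: mat_def)
  have "S Compressional Compressional + S Compressional Shear + S Shear Compressional + S Shear Shear =
    (\<Sum>j\<in>UNIV. (polarization Compressional e $ r $ j + polarization Shear e $ r $ j) *
      cnj (polarization Compressional e $ r $ j + polarization Shear e $ r $ j) * V j)"
    unfolding S_def sum.distrib[symmetric]
    by (intro sum.cong refl) (simp add: algebra_simps del: polarization.simps)
  also have "\<dots> = (\<Sum>j\<in>UNIV. if r = j then V j else 0)"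
    unfolding I by (intro sum.cong) auto
  also have "\<dots> = V r" by simp
  finally show ?thesis .
qed

theorem theorem4:
  fixes a lam mu :: real
  assumes "a > 0" and "mu > 0" and "lam + mu > 0"
  shows "\<exists>\<kappa>>0. \<forall>\<omega>\<^sub>0. 0 < \<omega>\<^sub>0 \<and> \<omega>\<^sub>0 < \<kappa> \<longrightarrow>
    (\<forall>d::real^2. norm d = 1 \<longrightarrow>
      (\<forall>l::int^2. \<forall>(M::'w measure) W g \<sigma> (M'::'v measure) W' g' \<sigma>'.
        brownian_sheet_pair M W \<and> admissible_source a g \<sigma> \<and>
        brownian_sheet_pair M' W' \<and> admissible_source a g' \<sigma>' \<and>
        (\<forall>m n. covariance_data a lam mu M W g \<sigma> \<omega>\<^sub>0 d l m n =
               covariance_data a lam mu M' W' g' \<sigma>' \<omega>\<^sub>0 d l m n) \<longrightarrow>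
        variance_coeff a \<sigma> l = variance_coeff a \<sigma>' l))"
proof (intro exI[of _ 1] conjI allI impI; (elim conjE)?)
  \<comment> \<open>The covariance formula is an exact identity at each frequency rather than an
    asymptotic one, which is why \<open>\<kappa>\<close> can be fixed as 1.\<close>
  fix \<omega>\<^sub>0 :: real and d :: "real^2" and l :: "int^2"
    and M :: "'w measure" and W g \<sigma> and M' :: "'v measure" and W' g' \<sigma>'
  assume \<omega>: "0 < \<omega>\<^sub>0"
    and src: "brownian_sheet_pair M W" "admissible_source a g \<sigma>"
    and src': "brownian_sheet_pair M' W'" "admissible_source a g' \<sigma>'"
    and data: "\<forall>m n. covariance_data a lam mu M W g \<sigma> \<omega>\<^sub>0 d l m n =
               covariance_data a lam mu M' W' g' \<sigma>' \<omega>\<^sub>0 d l m n"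
  define V where "V \<sigma> j = (LINT y|lebesgue. indicator (domain_square a) y *
      (cnj (fourier_basis a l y) * of_real ((\<sigma> y $ j)\<^sup>2)))" for \<sigma> :: "real^2 \<Rightarrow> real^2" and j
  define c where "c m k = gamma_coeff k * of_real (1 / (wave_speed lam mu m)\<^sup>2)" for m k
  define S where "S \<sigma> m n r = (\<Sum>j\<in>UNIV. polarization m (obs_direction d l) $ r $ j *
      cnj (polarization n (obs_direction d l) $ r $ j) * V \<sigma> j)" for \<sigma> m n r
  have k: "\<omega>\<^sub>0 + tau a l > 0" using \<omega> assms(1) by (simp add: tau_def add_pos_nonneg)
  have speed: "wave_speed lam mu m \<noteq> 0" for m using assms by (cases m) auto
  have nz: "c m k \<noteq> 0" if "k > 0" for m k
    using gamma_coeff_nonzero[OF that] speed[of m] by (simp add: c_def)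
  \<comment> \<open>The prefactor depends on the frequencies and wave speeds but not on the source.
    It is therefore common to both sides, and being nonzero it cancels for each pair of
    modes.\<close>
  have "S \<sigma> m n r = S \<sigma>' m n r" for m n r
  proof -
    have "covariance_data a lam mu M W g \<sigma> \<omega>\<^sub>0 d l m n $ r $ r =
        c m (\<omega>\<^sub>0 + tau a l) * cnj (c n \<omega>\<^sub>0) * S \<sigma> m n r"
      unfolding covariance_data_eq[OF src assms(2,3,1) \<omega>] c_def S_def V_def by simp
    moreover have "covariance_data a lam mu M' W' g' \<sigma>' \<omega>\<^sub>0 d l m n $ r $ r =
        c m (\<omega>\<^sub>0 + tau a l) * cnj (c n \<omega>\<^sub>0) * S \<sigma>' m n r"
      unfolding covariance_data_eq[OF src' assms(2,3,1) \<omega>] c_def S_def V_def by simp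
    ultimately show ?thesis using data nz[OF k] nz[OF \<omega>] by simp
  qed
  then have "V \<sigma> r = V \<sigma>' r" for r
    using sum_polarizations[of "obs_direction d l" r "V \<sigma>"] sum_polarizations[of "obs_direction d l" r "V \<sigma>'"]
    by (simp add: S_def del: polarization.simps)
  then show "variance_coeff a \<sigma> l = variance_coeff a \<sigma>' l"
    unfolding variance_coeff_eq[OF src(2)] variance_coeff_eq[OF src'(2)] V_def[symmetric]
    by (simp cong: if_cong)
qed simp

end
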